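(* Let $\mathcal G$ be an undirected simple graph on $n$ nodes with $m$ edges and no isolated nodes, with adjacency matrix $\bm A$, degree matrix $\bm D=\mathrm{diag}(d_1,\dots,d_n)$ and maximum degree $d_{\max}$. Let $\alpha\in(0,1)$, $s$ a node, and $\bm x^*$ the unique solution of $\bm x=\alpha\bm e_s+(1-\alpha)\bm A\bm D^{-1}\bm x$. Let $\tilde{\bm P}=\bm D^{-1/2}\bm A\bm D^{-1/2}$, $\tilde{\bm s}=\bm D^{-1/2}\bm e_s$, and $f(\bm y)=\frac12\bm y^\top(\bm I-(1-\alpha)\tilde{\bm P})\bm y-\alpha\tilde{\bm s}^\top\bm y$. Let $\kappa=\sqrt{\alpha/(2-\alpha)}$, $\eta=1/(2-\alpha)$, $\beta=(1-\kappa)/(1+\kappa)$, and define the NAG iterates by $\bm z^0=\bm y^0=\bm 0$ and, for $t\ge1$, $$\bm z^t=\bm y^{t-1}-\eta\nabla f(\bm y^{t-1}),\qquad \bm y^t=\bm z^t+\beta(\bm z^t-\bm z^{t-1})$$ (equivalently, for $t\ge1$, $\bm y^{t+1}=2\eta'(\bm I+\tilde{\bm P})\bm y^t-(1-\kappa)\eta'(\bm I+\tilde{\bm P})\bm y^{t-1}+\kappa^2\tilde{\bm s}$ with $\eta'=(1-\alpha)/((2-\alpha)(1+\kappa))$). Let $\bm x^t=\bm D^{1/2}\bm y^t$. Then $$\|\bm x^t-\bm x^*\|_1\le d_{\max}\sqrt{\frac{2n}{\alpha}}\exp\Big(-\frac{t-1}{2\sqrt{(2-\alpha)/\alpha}}\Big),$$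 and, since each iteration costs $\mathcal O(m)$ operations, the total number of operations needed to guarantee $\|\bm x^t-\bm x^*\|_\infty\le\epsilon$ is $$\mathcal O\Big(\frac{m}{\sqrt\alpha}\log\Big(\frac{d_{\max}}{\epsilon}\sqrt{\frac{2n}{\alpha}}\Big)\Big).$$
   Context: The unique minimizer $\bm y^*$ of the strongly convex quadratic $f$ satisfies $\bm x^*=\bm D^{1/2}\bm y^*$. Operations are counted as arithmetic operations on vector entries; one iteration requires one multiplication by the sparse matrix $\tilde{\bm P}$. *)

theory Defs
  imports
    "HOL-Analysis.Derivative"
    "HOL-Library.State_Monad"
    "Jordan_Normal_Form.Matrix"
begin

unbundle no inner_syntax and no vec_syntax

section \<open>Graphs and their matrices\<close>

text \<open>Nodes are \<open>0, \<dots>, n - 1\<close>; an edge is a two-element set of nodes.\<close>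

definition simple_graph :: "nat \<Rightarrow> nat set set \<Rightarrow> bool" where
  "simple_graph n E \<longleftrightarrow> (\<forall>e\<in>E. e \<subseteq> {..<n} \<and> card e = 2)"

definition vdegree :: "nat set set \<Rightarrow> nat \<Rightarrow> nat" where
  "vdegree E v = card {e \<in> E. v \<in> e}"

definition no_isolated :: "nat \<Rightarrow> nat set set \<Rightarrow> bool" where
  "no_isolated n E \<longleftrightarrow> (\<forall>v<n. \<exists>e\<in>E. v \<in> e)"

definition max_degree :: "nat \<Rightarrow> nat set set \<Rightarrow> nat" where
  "max_degree n E = Max (vdegree E ` {..<n})"

definition adj_mat :: "nat \<Rightarrow> nat set set \<Rightarrow> real mat" where
  "adj_mat n E = mat n n (\<lambda>(i, j). if {i, j} \<in> E then 1 else 0)"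

text \<open>The real power \<open>D\<^sup>p\<close> of the diagonal degree matrix, meant for positive degrees.\<close>

definition deg_pow :: "nat \<Rightarrow> nat set set \<Rightarrow> real \<Rightarrow> real mat" where
  "deg_pow n E p = mat_diag n (\<lambda>i. real (vdegree E i) powr p)"

definition P_mat :: "nat \<Rightarrow> nat set set \<Rightarrow> real mat" where
  "P_mat n E = deg_pow n E (- 1 / 2) * adj_mat n E * deg_pow n E (- 1 / 2)"

definition s_vec :: "nat \<Rightarrow> nat set set \<Rightarrow> nat \<Rightarrow> real vec" where
  "s_vec n E s = deg_pow n E (- 1 / 2) *\<^sub>v unit_vec n s"

definition ppr_eq :: "nat \<Rightarrow> nat set set \<Rightarrow> real \<Rightarrow> nat \<Rightarrow> real vec \<Rightarrow> bool" where
  "ppr_eq n E \<alpha> s x \<longleftrightarrow> x \<in> carrier_vec n \<and>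
     x = \<alpha> \<cdot>\<^sub>v unit_vec n s + (1 - \<alpha>) \<cdot>\<^sub>v ((adj_mat n E * deg_pow n E (- 1)) *\<^sub>v x)"

definition ppr :: "nat \<Rightarrow> nat set set \<Rightarrow> real \<Rightarrow> nat \<Rightarrow> real vec" where
  "ppr n E \<alpha> s = (THE x. ppr_eq n E \<alpha> s x)"

definition norm1 :: "real vec \<Rightarrow> real" where
  "norm1 v = (\<Sum>i<dim_vec v. \<bar>v $ i\<bar>)"

text \<open>Meaningful only in positive dimension.\<close>

definition norm_inf :: "real vec \<Rightarrow> real" where
  "norm_inf v = Max ((\<lambda>i. \<bar>v $ i\<bar>) ` {..<dim_vec v})"

section \<open>The objective and the NAG iterates\<close>

definition quad :: "nat \<Rightarrow> nat set set \<Rightarrow> real \<Rightarrow> nat \<Rightarrow> real vec \<Rightarrow> real" where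
  "quad n E \<alpha> s y =
     1 / 2 * (y \<bullet> ((1\<^sub>m n - (1 - \<alpha>) \<cdot>\<^sub>m P_mat n E) *\<^sub>v y)) - \<alpha> * (s_vec n E s \<bullet> y)"

text \<open>\<open>has_derivative\<close> needs a normed vector type, which \<open>real vec\<close> is not (its dimension
  varies), so the gradient is given by its partial derivatives.\<close>

definition grad :: "(real vec \<Rightarrow> real) \<Rightarrow> real vec \<Rightarrow> real vec" where
  "grad f y = vec (dim_vec y) (\<lambda>i. deriv (\<lambda>h. f (y + h \<cdot>\<^sub>v unit_vec (dim_vec y) i)) 0)"

definition kappa :: "real \<Rightarrow> real" where
  "kappa \<alpha> = sqrt (\<alpha> / (2 - \<alpha>))"

definition eta :: "real \<Rightarrow> real" where
  "eta \<alpha> = 1 / (2 - \<alpha>)"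

definition beta :: "real \<Rightarrow> real" where
  "beta \<alpha> = (1 - kappa \<alpha>) / (1 + kappa \<alpha>)"

definition eta' :: "real \<Rightarrow> real" where
  "eta' \<alpha> = (1 - \<alpha>) / ((2 - \<alpha>) * (1 + kappa \<alpha>))"

text \<open>The state after \<open>t\<close> steps is the pair \<open>(z\<^sup>t, y\<^sup>t)\<close>.\<close>

fun nag :: "(real vec \<Rightarrow> real) \<Rightarrow> real \<Rightarrow> real \<Rightarrow> nat \<Rightarrow> nat \<Rightarrow> real vec \<times> real vec" where
  "nag f h b n 0 = (0\<^sub>v n, 0\<^sub>v n)"
| "nag f h b n (Suc t) =
     (let (z, y) = nag f h b n t;
          z' = y - h \<cdot>\<^sub>v grad f y;
          y' = z' + b \<cdot>\<^sub>v (z' - z)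
      in (z', y'))"

definition y_iter :: "nat \<Rightarrow> nat set set \<Rightarrow> real \<Rightarrow> nat \<Rightarrow> nat \<Rightarrow> real vec" where
  "y_iter n E \<alpha> s t = snd (nag (quad n E \<alpha> s) (eta \<alpha>) (beta \<alpha>) n t)"

definition x_iter :: "nat \<Rightarrow> nat set set \<Rightarrow> real \<Rightarrow> nat \<Rightarrow> nat \<Rightarrow> real vec" where
  "x_iter n E \<alpha> s t = deg_pow n E (1 / 2) *\<^sub>v y_iter n E \<alpha> s t"

section \<open>The method as a program with counted arithmetic\<close>

text \<open>The state is the number of arithmetic operations on vector entries performed so far.
  Programs below compute with entries only through \<open>add_op\<close>, \<open>sub_op\<close> and \<open>mul_op\<close>, each
  of which charges one operation. Reading and copying entries is free, and so is everything
  done once before the iteration (the data of the problem and the scalar parameters).\<close>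

type_synonym 'a counted = "(nat, 'a) state"

definition charge :: "'a \<Rightarrow> 'a counted" where
  "charge r = State (\<lambda>k. (r, Suc k))"

definition add_op :: "real \<Rightarrow> real \<Rightarrow> real counted" where
  "add_op a b = charge (a + b)"

definition sub_op :: "real \<Rightarrow> real \<Rightarrow> real counted" where
  "sub_op a b = charge (a - b)"

definition mul_op :: "real \<Rightarrow> real \<Rightarrow> real counted" where
  "mul_op a b = charge (a * b)"

definition zip_op :: "(real \<Rightarrow> real \<Rightarrow> real counted) \<Rightarrow> real list \<Rightarrow> real list \<Rightarrow> real list counted" where
  "zip_op f xs ys = State_Monad.traverse_list (\<lambda>(x, y). f x y) (zip xs ys)"

definition scale_op :: "real \<Rightarrow> real list \<Rightarrow> real list counted" where
  "scale_op c xs = State_Monad.traverse_list (mul_op c) xs"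

text \<open>A sparse matrix is the list of its rows, and a row the list of its nonzero entries, each
  paired with its column.\<close>

definition sparse_rows :: "real mat \<Rightarrow> (nat \<times> real) list list" where
  "sparse_rows M =
     map (\<lambda>i. map (\<lambda>j. (j, M $$ (i, j))) (filter (\<lambda>j. M $$ (i, j) \<noteq> 0) [0..<dim_col M]))
       [0..<dim_row M]"

fun sparse_dot :: "real list \<Rightarrow> (nat \<times> real) list \<Rightarrow> real counted" where
  "sparse_dot ys [] = State_Monad.return 0"
| "sparse_dot ys ((j, p) # r) =
     do { a \<leftarrow> mul_op p (ys ! j); b \<leftarrow> sparse_dot ys r; add_op a b }"

definition sparse_mult :: "(nat \<times> real) list list \<Rightarrow> real list \<Rightarrow> real list counted" where
  "sparse_mult R ys = State_Monad.traverse_list (sparse_dot ys) R"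

text \<open>One iteration on \<open>(z\<^sup>t, y\<^sup>t, x\<^sup>t)\<close>, with one product by the sparse matrix \<open>R\<close>.
  The vectors \<open>sv\<close> and \<open>dv\<close> are the vector \<open>D\<^sup>-\<^sup>1\<^sup>/\<^sup>2 e\<^sub>s\<close> and the diagonal of \<open>D\<^sup>1\<^sup>/\<^sup>2\<close>;
  \<open>g\<close> is the gradient of \<open>quad\<close> at \<open>y\<^sup>t\<close>.\<close>

definition nag_step ::
  "(nat \<times> real) list list \<Rightarrow> real list \<Rightarrow> real list \<Rightarrow> real \<Rightarrow>
   real list \<times> real list \<times> real list \<Rightarrow> (real list \<times> real list \<times> real list) counted" where
  "nag_step R sv dv \<alpha> = (\<lambda>(z, y, x). do {
     p \<leftarrow> sparse_mult R y;
     p' \<leftarrow> scale_op (1 - \<alpha>) p;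
     q \<leftarrow> zip_op sub_op y p';
     r \<leftarrow> scale_op \<alpha> sv;
     g \<leftarrow> zip_op sub_op q r;
     g' \<leftarrow> scale_op (eta \<alpha>) g;
     z' \<leftarrow> zip_op sub_op y g';
     d \<leftarrow> zip_op sub_op z' z;
     d' \<leftarrow> scale_op (beta \<alpha>) d;
     y' \<leftarrow> zip_op add_op z' d';
     x' \<leftarrow> zip_op mul_op dv y';
     State_Monad.return (z', y', x') })"

fun nag_prog ::
  "nat \<Rightarrow> nat set set \<Rightarrow> real \<Rightarrow> nat \<Rightarrow> nat \<Rightarrow> (real list \<times> real list \<times> real list) counted" where
  "nag_prog n E \<alpha> s 0 =
     State_Monad.return (replicate n 0, replicate n 0, replicate n 0)"
| "nag_prog n E \<alpha> s (Suc t) =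
     do { st \<leftarrow> nag_prog n E \<alpha> s t;
          nag_step (sparse_rows (P_mat n E)) (list_of_vec (s_vec n E s))
            (diag_mat (deg_pow n E (1 / 2))) \<alpha> st }"

definition nag_output :: "nat \<Rightarrow> nat set set \<Rightarrow> real \<Rightarrow> nat \<Rightarrow> nat \<Rightarrow> real vec" where
  "nag_output n E \<alpha> s t = vec_of_list (snd (snd (fst (run_state (nag_prog n E \<alpha> s t) 0))))"

definition nag_ops :: "nat \<Rightarrow> nat set set \<Rightarrow> real \<Rightarrow> nat \<Rightarrow> nat \<Rightarrow> nat" where
  "nag_ops n E \<alpha> s t = snd (run_state (nag_prog n E \<alpha> s t) 0)"

end

theory Submission
  imports Defs "Jordan_Normal_Form.Determinant"
begin

text \<open>
  Put \<open>H = I - (1 - \<alpha>) P\<close>. Since \<open>\<Sum> A\<^sub>i\<^sub>j (v\<^sub>i / \<surd>d\<^sub>i \<plusminus> v\<^sub>j / \<surd>d\<^sub>j)\<^sup>2 \<ge> 0\<close>,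
  the spectrum of \<open>H\<close> lies in \<open>[\<alpha>, 2 - \<alpha>]\<close>; so \<open>H y = \<alpha> s\<close> has a unique solution \<open>y\<^sup>*\<close>, and
  \<open>x\<^sup>* = D\<^sup>1\<^sup>/\<^sup>2 y\<^sup>*\<close>. With \<open>a = z\<^sup>t - y\<^sup>*\<close>, \<open>e = y\<^sup>t - y\<^sup>*\<close> and \<open>b\<close> given by
  \<open>(1 + \<kappa>) e = a + \<kappa> b\<close>, the Lyapunov function \<open>V = a\<^sup>T H a / 2 + \<alpha> |b|\<^sup>2 / 2\<close> contracts by \<open>1 - \<kappa>\<close> in
  each step and dominates \<open>\<alpha> |e|\<^sup>2 / 2\<close>. Initially \<open>V \<le> \<alpha>\<close>, hence \<open>|e|\<^sup>2 \<le> 2 exp (- \<kappa> t)\<close>, and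
  \<open>|x\<^sup>t - x\<^sup>*|\<^sub>1 \<le> \<surd>(n d\<^sub>m\<^sub>a\<^sub>x) |e|\<close> by Cauchy-Schwarz. An iteration costs \<open>4 m + 10 n\<close> operations and
  \<open>n \<le> 2 m\<close>.
\<close>

section \<open>Nesterov's method on a quadratic\<close>

lemma scalar_prod_self_nonneg: "0 \<le> (v :: real vec) \<bullet> v"
  by (simp add: scalar_prod_def sum_nonneg)

lemma scalar_prod_symmetric_mat:
  fixes H :: "real mat"
  assumes H: "H \<in> carrier_mat n n" and sym: "\<And>i j. i < n \<Longrightarrow> j < n \<Longrightarrow> H $$ (i, j) = H $$ (j, i)"
    and uv: "u \<in> carrier_vec n" "v \<in> carrier_vec n"
  shows "u \<bullet> (H *\<^sub>v v) = v \<bullet> (H *\<^sub>v u)"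
proof -
  have "u \<bullet> (H *\<^sub>v v) = (\<Sum>i\<in>{0..<n}. \<Sum>j\<in>{0..<n}. u $ i * (H $$ (i, j) * v $ j))"
    using H uv by (simp add: scalar_prod_def sum_distrib_left row_def)
  also have "\<dots> = (\<Sum>i\<in>{0..<n}. \<Sum>j\<in>{0..<n}. u $ j * (H $$ (j, i) * v $ i))"
    by (rule sum.swap)
  also have "\<dots> = (\<Sum>i\<in>{0..<n}. \<Sum>j\<in>{0..<n}. v $ i * (H $$ (i, j) * u $ j))"
    by (intro sum.cong refl) (simp add: sym)
  also have "\<dots> = v \<bullet> (H *\<^sub>v u)"
    using H uv by (simp add: scalar_prod_def sum_distrib_left row_def)
  finally show ?thesis .
qed

lemma nag_carrier:
  assumes "\<And>y. y \<in> carrier_vec n \<Longrightarrow> grad f y \<in> carrier_vec n"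
  shows "fst (nag f h c n t) \<in> carrier_vec n" "snd (nag f h c n t) \<in> carrier_vec n"
  by (induction t) (simp_all add: Let_def case_prod_beta assms)

text \<open>\<open>\<kappa>\<close> is the inverse square root of the condition number
  \<open>L / \<mu>\<close>. Keeping the graph out makes the convergence argument a statement about
  any symmetric H with spectrum in [\<mu>, L].\<close>

locale symmetric_spectral_bounds =
  fixes n :: nat and H :: "real mat" and \<mu> L \<kappa> :: real
  assumes H [simp]: "H \<in> carrier_mat n n"
    and sym: "i < n \<Longrightarrow> j < n \<Longrightarrow> H $$ (i, j) = H $$ (j, i)"
    and lower: "v \<in> carrier_vec n \<Longrightarrow> \<mu> * (v \<bullet> v) \<le> v \<bullet> (H *\<^sub>v v)"
    and upper: "v \<in> carrier_vec n \<Longrightarrow> v \<bullet> (H *\<^sub>v v) \<le> L * (v \<bullet> v)"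
    and mu_pos: "0 < \<mu>" and L_pos: "0 < L"
    and kappa_pos: "0 < \<kappa>" and kappa_le: "\<kappa> \<le> 1" and kappa_sq: "\<kappa>\<^sup>2 * L = \<mu>"
begin

section \<open>Lyapunov analysis of the momentum iteration\<close>

lemma Hv [simp]: "v \<in> carrier_vec n \<Longrightarrow> H *\<^sub>v v \<in> carrier_vec n"
  by (rule mult_mat_vec_carrier[OF H])

text \<open>For \<open>a = z - ys\<close> the first term is the gap in objective value between z and
  the minimizer \<open>ys\<close>; the second is the weighted squared distance of an auxiliary point
  \<open>ys + b\<close>.\<close>

definition lyapunov :: "real vec \<Rightarrow> real vec \<Rightarrow> real" where
  "lyapunov a b = 1 / 2 * (a \<bullet> (H *\<^sub>v a)) + \<mu> / 2 * (b \<bullet> b)"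

text \<open>These rules expand forms bilinearly. Fixing the dimension n leaves carrier premises
  without unknowns, which the simplifier can discharge.\<close>

lemmas vec_expand = mult_add_distrib_mat_vec[OF H] mult_minus_distrib_mat_vec[OF H]
  mult_mat_vec[OF H] add_scalar_prod_distrib[of _ n] scalar_prod_add_distrib[of _ n]
  minus_scalar_prod_distrib[of _ n] scalar_prod_minus_distrib[of _ n]
  smult_scalar_prod_distrib[of _ n] scalar_prod_smult_distrib[of _ n]

text \<open>The loss \<open>(1 - \<kappa>) * V - V'\<close> is an explicit nonnegative combination
  of four slacks: the upper spectral bound at \<open>H *\<^sub>v e\<close>, the lower bound at e,
  and the H-form and squared norm of e - b. Here a solves (1 + \<kappa>) e = a + \<kappa> b, a' is a
  gradient step of length 1 / L, and b' is the matching update of the auxiliary point.\<close>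

lemma lyapunov_step:
  assumes e [simp]: "e \<in> carrier_vec n" and b [simp]: "b \<in> carrier_vec n"
  defines "a \<equiv> (1 + \<kappa>) \<cdot>\<^sub>v e - \<kappa> \<cdot>\<^sub>v b"
    and "a' \<equiv> e - (1 / L) \<cdot>\<^sub>v (H *\<^sub>v e)"
    and "b' \<equiv> (1 - \<kappa>) \<cdot>\<^sub>v b + \<kappa> \<cdot>\<^sub>v e - (\<kappa> / \<mu>) \<cdot>\<^sub>v (H *\<^sub>v e)"
  shows "lyapunov a' b' \<le> (1 - \<kappa>) * lyapunov a b"
proof -
  define g where "g = H *\<^sub>v e"
  have g [simp]: "g \<in> carrier_vec n" by (simp add: g_def)
  define eg ee eb bb gg bg gHg bHb
    where q: "eg = e \<bullet> g" "ee = e \<bullet> e" "eb = e \<bullet> b" "bb = b \<bullet> b" "gg = g \<bullet> g" "bg = b \<bullet> g"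
      "gHg = g \<bullet> (H *\<^sub>v g)" "bHb = b \<bullet> (H *\<^sub>v b)"
  \<comment> \<open>Symmetry of H turns the mixed forms of e with H b and H g into b . g and g . g,
    so eight scalars suffice.\<close>
  have r: "H *\<^sub>v e = g" "e \<bullet> g = eg" "g \<bullet> e = eg" "e \<bullet> e = ee" "e \<bullet> b = eb" "b \<bullet> e = eb"
    "b \<bullet> b = bb" "g \<bullet> g = gg" "b \<bullet> g = bg" "g \<bullet> b = bg" "g \<bullet> (H *\<^sub>v g) = gHg"
    "b \<bullet> (H *\<^sub>v b) = bHb" "e \<bullet> (H *\<^sub>v b) = bg" "e \<bullet> (H *\<^sub>v g) = gg"
    using scalar_prod_symmetric_mat[OF H sym e b] scalar_prod_symmetric_mat[OF H sym e g]
    by (auto simp: q g_def[symmetric] comm_scalar_prod[OF e g] comm_scalar_prod[OF e b]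
        comm_scalar_prod[OF b g])
  have "0 \<le> (e - b) \<bullet> (e - b)" by (rule scalar_prod_self_nonneg)
  then have dist: "0 \<le> ee - 2 * eb + bb"
    by (simp add: vec_expand r)
  moreover have "\<mu> * ((e - b) \<bullet> (e - b)) \<le> (e - b) \<bullet> (H *\<^sub>v (e - b))"
    by (rule lower) simp
  ultimately have distH: "0 \<le> eg - 2 * bg + bHb"
    using mu_pos by (simp add: vec_expand r) (smt (verit) mult_nonneg_nonneg)
  have lo: "\<mu> * ee \<le> eg" using lower[OF e] by (simp add: r)
  have up: "gHg \<le> L * gg" using upper[OF g] by (simp add: r)
  have V: "lyapunov a b = 1/2 * ((1 + \<kappa>)\<^sup>2 * eg - 2 * \<kappa> * (1 + \<kappa>) * bg + \<kappa>\<^sup>2 * bHb) + \<mu> / 2 * bb"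
    unfolding lyapunov_def a_def by (simp add: vec_expand r power2_eq_square) (simp add: algebra_simps)
  have V': "lyapunov a' b' = 1/2 * (eg - 2 / L * gg + gHg / L\<^sup>2)
     + \<mu> / 2 * ((1 - \<kappa>)\<^sup>2 * bb + 2 * \<kappa> * (1 - \<kappa>) * eb + \<kappa>\<^sup>2 * ee
        - 2 * (\<kappa> / \<mu>) * ((1 - \<kappa>) * bg + \<kappa> * eg) + (\<kappa> / \<mu>)\<^sup>2 * gg)"
    unfolding lyapunov_def a'_def b'_def using mu_pos L_pos
    by (simp add: vec_expand r power2_eq_square) (simp add: field_simps)
  \<comment> \<open>Substituting \<open>\<kappa>\<^sup>2 * L\<close> for \<mu> leaves a rational
    identity in \<kappa>, L and the eight scalars.\<close>
  have "(1 - \<kappa>) * lyapunov a b - lyapunov a' b' =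
      1 / (2 * L\<^sup>2) * (L * gg - gHg) + \<kappa> / 2 * (eg - \<mu> * ee)
      + (1 - \<kappa>) * \<kappa>\<^sup>2 / 2 * (eg - 2 * bg + bHb) + \<mu> * \<kappa> * (1 - \<kappa>) / 2 * (ee - 2 * eb + bb)"
    unfolding V V' unfolding kappa_sq[symmetric] using kappa_pos L_pos
    by (simp add: field_simps power2_eq_square)
  moreover have "0 \<le> 1 / (2 * L\<^sup>2) * (L * gg - gHg)" "0 \<le> \<kappa> / 2 * (eg - \<mu> * ee)"
    "0 \<le> (1 - \<kappa>) * \<kappa>\<^sup>2 / 2 * (eg - 2 * bg + bHb)"
    "0 \<le> \<mu> * \<kappa> * (1 - \<kappa>) / 2 * (ee - 2 * eb + bb)"
    using lo up dist distH kappa_pos kappa_le mu_pos L_pos by simp_all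
  ultimately show ?thesis by linarith
qed

text \<open>By the lower spectral bound \<open>lyapunov a b\<close> is at least \<mu>/2 times |a|^2
  + |b|^2, and the averaging relation gives |a|^2 + |b|^2 - |e|^2 = \<kappa> (1 + \<kappa>) |e -
  b|^2 + (1 - \<kappa>) |b|^2 + \<kappa> |e|^2.\<close>

lemma error_le_lyapunov:
  assumes a [simp]: "a \<in> carrier_vec n" and b [simp]: "b \<in> carrier_vec n" and e [simp]: "e \<in> carrier_vec n"
    and avg: "a = (1 + \<kappa>) \<cdot>\<^sub>v e - \<kappa> \<cdot>\<^sub>v b"
  shows "\<mu> / 2 * (e \<bullet> e) \<le> lyapunov a b"
proof -
  have "0 \<le> (e - b) \<bullet> (e - b)" by (rule scalar_prod_self_nonneg)
  then have "0 \<le> e \<bullet> e - 2 * (e \<bullet> b) + b \<bullet> b"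
    by (simp add: vec_expand comm_scalar_prod[OF b e])
  then have "0 \<le> \<mu> / 2 * (\<kappa> * (1 + \<kappa>) * (e \<bullet> e - 2 * (e \<bullet> b) + b \<bullet> b))"
    using mu_pos kappa_pos by simp
  moreover have "0 \<le> \<mu> / 2 * ((1 - \<kappa>) * (b \<bullet> b))" "0 \<le> \<mu> / 2 * (\<kappa> * (e \<bullet> e))"
    using mu_pos kappa_le kappa_pos scalar_prod_self_nonneg[of b] scalar_prod_self_nonneg[of e] by auto
  moreover have "a \<bullet> a = (1 + \<kappa>)\<^sup>2 * (e \<bullet> e) - 2 * \<kappa> * (1 + \<kappa>) * (e \<bullet> b) + \<kappa>\<^sup>2 * (b \<bullet> b)"
    unfolding avg by (simp add: vec_expand comm_scalar_prod[OF b e] power2_eq_square) (simp add: algebra_simps)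
  then have "\<mu> / 2 * (a \<bullet> a) + \<mu> / 2 * (b \<bullet> b) - \<mu> / 2 * (e \<bullet> e) =
      \<mu> / 2 * (\<kappa> * (1 + \<kappa>) * (e \<bullet> e - 2 * (e \<bullet> b) + b \<bullet> b))
      + \<mu> / 2 * ((1 - \<kappa>) * (b \<bullet> b)) + \<mu> / 2 * (\<kappa> * (e \<bullet> e))"
    by (simp only:) (simp add: algebra_simps power2_eq_square)
  ultimately have "\<mu> / 2 * (e \<bullet> e) \<le> \<mu> / 2 * (a \<bullet> a) + \<mu> / 2 * (b \<bullet> b)"
    by linarith
  also have "\<dots> \<le> lyapunov a b"
    using lower[OF a] by (simp add: lyapunov_def)
  finally show ?thesis .
qed

text \<open>The objective enters only through its affine gradient, which vanishes at
  \<open>ys\<close>. The vector b is no component of the state of \<open>nag\<close>, so the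
  induction quantifies it existentially, together with the averaging relation and the contracted
  bound.\<close>

lemma nag_quadratic_error:
  assumes grad: "\<And>y. y \<in> carrier_vec n \<Longrightarrow> grad f y = H *\<^sub>v y - H *\<^sub>v ys"
    and ys [simp]: "ys \<in> carrier_vec n"
  defines "y \<equiv> (\<lambda>t. snd (nag f (1 / L) ((1 - \<kappa>) / (1 + \<kappa>)) n t))"
  shows "\<mu> / 2 * ((y t - ys) \<bullet> (y t - ys)) \<le> (1 - \<kappa>) ^ t * lyapunov ys ys"
proof -
  define z where "z = (\<lambda>t. fst (nag f (1 / L) ((1 - \<kappa>) / (1 + \<kappa>)) n t))"
  have carr: "z t \<in> carrier_vec n" "y t \<in> carrier_vec n" for t
    unfolding z_def y_def by (simp_all add: grad nag_carrier)
  have z_Suc: "z (Suc t) = y t - (1 / L) \<cdot>\<^sub>v (H *\<^sub>v y t - H *\<^sub>v ys)" for t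
    using carr(2)[of t] by (simp add: z_def y_def Let_def case_prod_beta grad)
  have y_Suc: "y (Suc t) = z (Suc t) + ((1 - \<kappa>) / (1 + \<kappa>)) \<cdot>\<^sub>v (z (Suc t) - z t)" for t
    by (simp add: z_def y_def Let_def case_prod_beta)
  have "\<exists>b\<in>carrier_vec n. z t - ys = (1 + \<kappa>) \<cdot>\<^sub>v (y t - ys) - \<kappa> \<cdot>\<^sub>v b \<and>
      lyapunov (z t - ys) b \<le> (1 - \<kappa>) ^ t * lyapunov ys ys" (is "\<exists>b\<in>_. ?P t b")
  proof (induction t)
    case 0
    have neg: "0\<^sub>v n - ys = (- 1) \<cdot>\<^sub>v ys" by (intro eq_vecI) auto
    \<comment> \<open>Both iterates start at 0, so a = e = -ys and b = -ys satisfies the averaging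
      relation; the Lyapunov function is even.\<close>
    have "?P 0 (- 1 \<cdot>\<^sub>v ys)"
      unfolding z_def y_def nag.simps fst_conv snd_conv neg lyapunov_def
      by (simp add: vec_expand) (intro eq_vecI, auto simp: algebra_simps)
    then show ?case by (intro bexI) auto
  next
    case (Suc t)
    then obtain b where b [simp]: "b \<in> carrier_vec n" and P: "?P t b" by blast
    define e where "e = y t - ys"
    have e [simp]: "e \<in> carrier_vec n" using carr by (simp add: e_def)
    define b' where "b' = (1 - \<kappa>) \<cdot>\<^sub>v b + \<kappa> \<cdot>\<^sub>v e - (\<kappa> / \<mu>) \<cdot>\<^sub>v (H *\<^sub>v e)"
    have b' [simp]: "b' \<in> carrier_vec n" by (simp add: b'_def)
    have He: "H *\<^sub>v e = H *\<^sub>v y t - H *\<^sub>v ys"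
      unfolding e_def by (rule mult_minus_distrib_mat_vec[OF H]) (auto simp: carr)
    have a': "z (Suc t) - ys = e - (1 / L) \<cdot>\<^sub>v (H *\<^sub>v e)"
    proof -
      define w where "w = H *\<^sub>v e"
      have "w \<in> carrier_vec n" by (simp add: w_def)
      then show ?thesis
        unfolding z_Suc He[symmetric] w_def[symmetric] unfolding e_def using carr(2)[of t] carrier_vecD[OF ys]
        by (intro eq_vecI) (auto simp: carrier_vecD[OF ys])
    qed
    have "?P (Suc t) b'"
    proof
      have "lyapunov (z (Suc t) - ys) b' \<le> (1 - \<kappa>) * lyapunov (z t - ys) b"
        unfolding a' conjunct1[OF P, folded e_def] b'_def by (rule lyapunov_step) auto
      also have "\<dots> \<le> (1 - \<kappa>) * ((1 - \<kappa>) ^ t * lyapunov ys ys)"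
        using P kappa_le by (intro mult_left_mono) auto
      finally show "lyapunov (z (Suc t) - ys) b' \<le> (1 - \<kappa>) ^ Suc t * lyapunov ys ys" by simp
      show "z (Suc t) - ys = (1 + \<kappa>) \<cdot>\<^sub>v (y (Suc t) - ys) - \<kappa> \<cdot>\<^sub>v b'"
      proof (rule eq_vecI)
        fix i assume "i < dim_vec ((1 + \<kappa>) \<cdot>\<^sub>v (y (Suc t) - ys) - \<kappa> \<cdot>\<^sub>v b')"
        then have i: "i < n" using b' by (simp add: carrier_vecD)
        have dims: "dim_vec (z t) = n" "dim_vec (y t) = n" "dim_vec ys = n" "dim_vec b = n"
          "dim_vec (z (Suc t)) = n" "dim_vec (y (Suc t)) = n" "dim_vec e = n" "dim_vec b' = n"
          "dim_vec (H *\<^sub>v e) = n"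
          using carr[of t] carr[of "Suc t"] b e b' Hv[OF e] by (auto simp only: carrier_vecD ys)
        define h where "h = (H *\<^sub>v e) $ i"
        have 1: "z (Suc t) $ i = ys $ i + e $ i - h / L"
          using arg_cong[OF a', of "\<lambda>v. v $ i"] i dims by (simp add: h_def)
        have 2: "b' $ i = (1 - \<kappa>) * b $ i + \<kappa> * e $ i - \<kappa> / \<mu> * h"
          using i by (simp add: b'_def h_def dims carrier_matD[OF H])
        have 3: "z t $ i = ys $ i + (1 + \<kappa>) * e $ i - \<kappa> * b $ i"
          using arg_cong[OF conjunct1[OF P, folded e_def], of "\<lambda>v. v $ i"] i dims by simp
        \<comment> \<open>The momentum coefficient is chosen so that adding 1 to it gives 2 / (1 +
          \<kappa>); this is the update with the denominator cleared.\<close>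
        have 4: "(1 + \<kappa>) * y (Suc t) $ i = 2 * z (Suc t) $ i - (1 - \<kappa>) * z t $ i"
          using i dims kappa_pos by (simp add: y_Suc field_simps)
        \<comment> \<open>The gradient terms cancel because
          \<open>\<kappa>\<^sup>2 / \<mu> = 1 / L\<close>: this couples the two step lengths 1 / L
          and \<kappa> / \<mu>.\<close>
        have k: "\<kappa> * (\<kappa> / \<mu> * h) = h / L"
          using kappa_pos L_pos by (simp add: kappa_sq[symmetric] power2_eq_square)
        have "(1 + \<kappa>) * (y (Suc t) $ i - ys $ i) - \<kappa> * b' $ i = z (Suc t) $ i - ys $ i"
          unfolding right_diff_distrib 4 unfolding 1 2 3
          using k by (simp add: algebra_simps power2_eq_square)
        then show "(z (Suc t) - ys) $ i = ((1 + \<kappa>) \<cdot>\<^sub>v (y (Suc t) - ys) - \<kappa> \<cdot>\<^sub>v b') $ i"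
          using i by (simp add: dims)
      qed (simp add: carrier_vecD[OF ys] carrier_vecD[OF b'])
    qed
    then show ?case using b' by (rule bexI)
  qed
  then obtain b where b: "b \<in> carrier_vec n" "?P t b" by blast
  have "\<mu> / 2 * ((y t - ys) \<bullet> (y t - ys)) \<le> lyapunov (z t - ys) b"
    by (rule error_le_lyapunov) (use b carr in auto)
  with b show ?thesis by linarith
qed

end

section \<open>The graph and the spectrum of the normalised adjacency matrix\<close>

lemma powr_neg_half: "0 < x \<Longrightarrow> x powr - (1 / 2) = 1 / sqrt (x :: real)"
  using powr_minus_divide[of x "1 / 2"] by (simp add: powr_half_sqrt)

locale ppr_problem =
  fixes n :: nat and E :: "nat set set" and \<alpha> :: real and s :: nat
  assumes graph: "simple_graph n E" and no_isolated: "no_isolated n E"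
    and alpha_pos: "0 < \<alpha>" and alpha_less: "\<alpha> < 1" and s_less: "s < n"
begin

section \<open>Degrees, neighbours and edge counts\<close>

lemma finite_E: "finite E"
  by (rule finite_subset[of _ "Pow {..<n}"]) (use graph in \<open>auto simp: simple_graph_def\<close>)

abbreviation "deg i \<equiv> real (vdegree E i)"
abbreviation "adj i j \<equiv> (if {i, j} \<in> E then 1 else 0 :: real)"
abbreviation "dmax \<equiv> real (max_degree n E)"
abbreviation "P \<equiv> P_mat n E"
abbreviation "H \<equiv> 1\<^sub>m n - (1 - \<alpha>) \<cdot>\<^sub>m P"
abbreviation "sv \<equiv> s_vec n E s"

text \<open>Sending a neighbour j to the edge {i, j} is a bijection onto the edges at i, since every
  edge has exactly two elements. This links degrees to row sums of the adjacency matrix.\<close>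

lemma vdegree_eq_card_neighbours:
  assumes "i < n" shows "vdegree E i = card {j. j < n \<and> {i, j} \<in> E}"
proof -
  have "bij_betw (\<lambda>j. {i, j}) {j. j < n \<and> {i, j} \<in> E} {e \<in> E. i \<in> e}"
    unfolding bij_betw_def
  proof
    show "inj_on (\<lambda>j. {i, j}) {j. j < n \<and> {i, j} \<in> E}"
      by (auto simp: inj_on_def doubleton_eq_iff)
    have "\<exists>j<n. e = {i, j}" if e: "e \<in> E" "i \<in> e" for e
    proof -
      have "e \<subseteq> {..<n}" "card e = 2" using graph e by (auto simp: simple_graph_def)
      then obtain j k where "e = {j, k}" by (auto simp: card_2_iff)
      with e \<open>e \<subseteq> {..<n}\<close> show ?thesis by (auto simp: doubleton_eq_iff)
    qed
    then show "(\<lambda>j. {i, j}) ` {j. j < n \<and> {i, j} \<in> E} = {e \<in> E. i \<in> e}" by blast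
  qed
  then show ?thesis unfolding vdegree_def by (rule bij_betw_same_card[symmetric])
qed

lemma sum_adj: assumes "i < n" shows "(\<Sum>j = 0..<n. adj i j) = deg i"
proof -
  have "{0..<n} \<inter> {j. {i, j} \<in> E} = {j. j < n \<and> {i, j} \<in> E}" by auto
  then show ?thesis by (simp add: vdegree_eq_card_neighbours[OF assms] sum.If_cases)
qed

lemma adj_commute: "adj i j = adj j i" by (simp add: insert_commute)

lemma vdegree_pos: "i < n \<Longrightarrow> 1 \<le> vdegree E i"
proof -
  assume "i < n"
  then have "{e \<in> E. i \<in> e} \<noteq> {}" using no_isolated by (auto simp: no_isolated_def)
  then show ?thesis
    unfolding vdegree_def using finite_E by (simp add: Suc_le_eq card_gt_0_iff)
qed

lemma deg_pos: "i < n \<Longrightarrow> 0 < deg i" using vdegree_pos[of i] by simp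

lemma deg_le_dmax: "i < n \<Longrightarrow> deg i \<le> dmax"
  by (simp add: max_degree_def)

lemma dmax_ge_1: "1 \<le> dmax"
  using vdegree_pos[OF s_less] deg_le_dmax[OF s_less] by linarith

text \<open>Handshake lemma, by counting incident pairs of a node and an edge in both
  orders.\<close>

lemma sum_vdegree: "(\<Sum>i<n. vdegree E i) = 2 * card E"
proof -
  have "(\<Sum>i<n. vdegree E i) = (\<Sum>i<n. \<Sum>e\<in>E. if i \<in> e then 1 else 0)"
    using finite_E by (simp add: vdegree_def sum.If_cases Collect_conj_eq Int_commute)
  also have "\<dots> = (\<Sum>e\<in>E. \<Sum>i<n. if i \<in> e then 1 else 0)" by (rule sum.swap)
  also have "\<dots> = (\<Sum>e\<in>E. 2)"
  proof (rule sum.cong)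
    fix e assume "e \<in> E"
    then have "{..<n} \<inter> {i. i \<in> e} = e" "card e = 2" using graph by (auto simp: simple_graph_def)
    then show "(\<Sum>i<n. if i \<in> e then 1 else 0) = (2 :: nat)" by (simp add: sum.If_cases)
  qed simp
  finally show ?thesis by simp
qed

text \<open>Each node contributes at least 1 to the degree sum; this absorbs the vector operations
  into the O(m) cost.\<close>

lemma n_le: "n \<le> 2 * card E"
proof -
  have "(\<Sum>i<n. 1) \<le> (\<Sum>i<n. vdegree E i)" by (intro sum_mono vdegree_pos) simp
  then show ?thesis by (simp add: sum_vdegree)
qed

section \<open>Powers of the degree matrix\<close>

lemma deg_pow_carrier [simp]: "deg_pow n E p \<in> carrier_mat n n"
  by (simp add: deg_pow_def)

lemma deg_pow_add: "deg_pow n E p * deg_pow n E q = deg_pow n E (p + q)"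
  by (simp add: deg_pow_def powr_add)

text \<open>Positive degrees matter here because \<open>0 powr 0 = 0\<close>.\<close>

lemma deg_pow_0: "deg_pow n E 0 = 1\<^sub>m n"
  using deg_pos by (intro eq_matI) (force simp: deg_pow_def mat_diag_def)+

lemma deg_pow_mult_vec:
  "v \<in> carrier_vec n \<Longrightarrow> deg_pow n E p *\<^sub>v v = vec n (\<lambda>i. deg i powr p * v $ i)"
  by (intro eq_vecI)
    (auto simp: deg_pow_def mat_diag_def scalar_prod_def if_distrib[of "\<lambda>x. x * _"] cong: if_cong)

lemma deg_pow_inverse_mult_vec:
  "v \<in> carrier_vec n \<Longrightarrow> deg_pow n E (- 1 / 2) *\<^sub>v (deg_pow n E (1 / 2) *\<^sub>v v) = v"
  "v \<in> carrier_vec n \<Longrightarrow> deg_pow n E (1 / 2) *\<^sub>v (deg_pow n E (- 1 / 2) *\<^sub>v v) = v"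
  by (simp_all add: assoc_mult_mat_vec[of _ n n _ n, symmetric] deg_pow_add deg_pow_0 del: assoc_mult_mat_vec)

text \<open>Unqualified, \<open>adj_mat\<close> is the adjugate of \<open>Jordan_Normal_Form.Determinant\<close>.\<close>

lemma adj_mat_carrier [simp]: "Defs.adj_mat n E \<in> carrier_mat n n" by (simp add: Defs.adj_mat_def)

section \<open>Entries and spectral bounds of P and H\<close>

lemma P_carrier [simp]: "P \<in> carrier_mat n n"
  unfolding P_mat_def by (intro mult_carrier_mat[of _ _ n]) simp_all

lemma H_carrier [simp]: "H \<in> carrier_mat n n"
  by (rule minus_carrier_mat) simp

lemma P_entry: "i < n \<Longrightarrow> j < n \<Longrightarrow> P $$ (i, j) = adj i j / (sqrt (deg i) * sqrt (deg j))"
  using deg_pos[of i] deg_pos[of j]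
  by (simp add: P_mat_def deg_pow_def mat_diag_mult_left[of _ n n] mat_diag_mult_right[of _ n n]
      Defs.adj_mat_def powr_neg_half)

lemma P_mult_carrier [simp]: "v \<in> carrier_vec n \<Longrightarrow> P *\<^sub>v v \<in> carrier_vec n"
  by (rule mult_mat_vec_carrier[OF P_carrier])

lemma H_mult_vec: "v \<in> carrier_vec n \<Longrightarrow> H *\<^sub>v v = v - (1 - \<alpha>) \<cdot>\<^sub>v (P *\<^sub>v v)"
  by (subst minus_mult_distrib_mat_vec[of _ n n])
    (auto intro!: eq_vecI simp: carrier_matD[OF P_carrier] smult_scalar_prod_distrib[of _ n])

lemma H_sym: "i < n \<Longrightarrow> j < n \<Longrightarrow> H $$ (i, j) = H $$ (j, i)"
  by (simp add: carrier_matD[OF P_carrier] P_entry adj_commute mult.commute)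

text \<open>In the edge-weighted sum of (u i - \<sigma> u j)^2 each of the two square parts adds up
  to v . v, because the rows of the adjacency matrix sum to the degrees. The choices \<sigma> = 1
  and \<sigma> = -1 bound the spectrum of P from above and below.\<close>

lemma P_form_le:
  assumes v: "v \<in> carrier_vec n" and sgn: "\<sigma>\<^sup>2 = (1 :: real)"
  shows "\<sigma> * (v \<bullet> (P *\<^sub>v v)) \<le> v \<bullet> v"
proof -
  define u where "u i = v $ i / sqrt (deg i)" for i
  have sq: "deg i * (u i)\<^sup>2 = v $ i * v $ i" if "i < n" for i
    using deg_pos[OF that] by (simp add: u_def power2_eq_square)
  have vv: "(\<Sum>i = 0..<n. \<Sum>j = 0..<n. adj i j * (u i)\<^sup>2) = v \<bullet> v"
    using v by (simp add: scalar_prod_def sum_distrib_right[symmetric] sum_adj sq del: mult_if_delta)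
  then have vv': "(\<Sum>i = 0..<n. \<Sum>j = 0..<n. adj i j * (u j)\<^sup>2) = v \<bullet> v"
    by (subst sum.swap) (simp add: adj_commute)
  have vPv: "v \<bullet> (P *\<^sub>v v) = (\<Sum>i = 0..<n. \<Sum>j = 0..<n. adj i j * (u i * u j))"
    using v by (simp add: scalar_prod_def sum_distrib_left P_entry u_def carrier_matD[OF P_carrier]
        del: mult_if_delta) (intro sum.cong refl, simp)
  have "0 \<le> (\<Sum>i = 0..<n. \<Sum>j = 0..<n. adj i j * (u i - \<sigma> * u j)\<^sup>2)"
    by (intro sum_nonneg) simp
  also have "\<dots> = (\<Sum>i = 0..<n. \<Sum>j = 0..<n. adj i j * (u i)\<^sup>2 + adj i j * (u j)\<^sup>2 - 2 * \<sigma> * (adj i j * (u i * u j)))"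
    using sgn by (intro sum.cong refl) (simp add: power2_diff power_mult_distrib)
  also have "\<dots> = v \<bullet> v + v \<bullet> v - 2 * \<sigma> * (v \<bullet> (P *\<^sub>v v))"
    unfolding vPv by (simp only: sum.distrib sum_subtractf sum_distrib_left[symmetric] vv vv')
  finally show ?thesis by simp
qed

lemma H_form: "v \<in> carrier_vec n \<Longrightarrow> v \<bullet> (H *\<^sub>v v) = v \<bullet> v - (1 - \<alpha>) * (v \<bullet> (P *\<^sub>v v))"
  by (simp add: H_mult_vec scalar_prod_minus_distrib[of _ n] scalar_prod_smult_distrib[of _ n])

lemma kappa_sq: "(kappa \<alpha>)\<^sup>2 = \<alpha> / (2 - \<alpha>)"
  using alpha_pos alpha_less by (simp add: kappa_def)

lemma kappa_pos: "0 < kappa \<alpha>" using alpha_pos alpha_less by (simp add: kappa_def)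

lemma kappa_le_1: "kappa \<alpha> \<le> 1"
  using alpha_pos alpha_less by (simp add: kappa_def)

sublocale symmetric_spectral_bounds n H \<alpha> "2 - \<alpha>" "kappa \<alpha>"
proof
  fix v :: "real vec" assume v: "v \<in> carrier_vec n"
  have "(1 - \<alpha>) * (1 * (v \<bullet> (P *\<^sub>v v))) \<le> (1 - \<alpha>) * (v \<bullet> v)"
    "(1 - \<alpha>) * ((- 1) * (v \<bullet> (P *\<^sub>v v))) \<le> (1 - \<alpha>) * (v \<bullet> v)"
    by (rule mult_left_mono[OF P_form_le[OF v]]; use alpha_less in simp)+
  then show "\<alpha> * (v \<bullet> v) \<le> v \<bullet> (H *\<^sub>v v)" "v \<bullet> (H *\<^sub>v v) \<le> (2 - \<alpha>) * (v \<bullet> v)"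
    by (simp_all add: H_form[OF v] algebra_simps)
qed (use alpha_pos alpha_less kappa_pos kappa_le_1 in \<open>simp_all add: kappa_sq H_sym\<close>)

section \<open>The linear term, the gradient and the optimality system\<close>

lemma sv_carrier [simp]: "sv \<in> carrier_vec n"
  unfolding s_vec_def by (rule mult_mat_vec_carrier[of _ n n]) simp_all

lemma sv_norm: "sv \<bullet> sv \<le> 1"
proof -
  have sv: "sv = (1 / sqrt (deg s)) \<cdot>\<^sub>v unit_vec n s"
    unfolding s_vec_def using deg_pos s_less
    by (intro eq_vecI) (auto simp: deg_pow_mult_vec powr_neg_half unit_vec_def)
  have "sv \<bullet> sv = 1 / deg s"
    unfolding sv using deg_pos[OF s_less] s_less
    by (simp add: smult_scalar_prod_distrib[of _ n] scalar_prod_smult_distrib[of _ n])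
  with vdegree_pos[OF s_less] show ?thesis by simp
qed

text \<open>Along a coordinate direction the objective is exactly a quadratic polynomial in h.
  Symmetry of H merges the two cross terms, and the coefficient of h is the partial
  derivative.\<close>

lemma grad_quad:
  assumes y [simp]: "y \<in> carrier_vec n"
  shows "grad (quad n E \<alpha> s) y = H *\<^sub>v y - \<alpha> \<cdot>\<^sub>v sv"
proof (rule eq_vecI)
  fix i assume "i < dim_vec (H *\<^sub>v y - \<alpha> \<cdot>\<^sub>v sv)"
  then have i: "i < n" by (simp add: carrier_vecD[OF sv_carrier])
  define u :: "real vec" where "u = unit_vec n i"
  have u [simp]: "u \<in> carrier_vec n" by (simp add: u_def)
  have Hy: "u \<bullet> (H *\<^sub>v y) = (H *\<^sub>v y) $ i" and su: "sv \<bullet> u = sv $ i"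
    using i sv_carrier Hv[OF y] unfolding u_def by simp_all
  have "quad n E \<alpha> s (y + h \<cdot>\<^sub>v u) = quad n E \<alpha> s y + h * ((H *\<^sub>v y) $ i - \<alpha> * sv $ i)
      + h * h * (u \<bullet> (H *\<^sub>v u) / 2)" for h
    unfolding quad_def by (simp add: vec_expand scalar_prod_symmetric_mat[OF H_carrier H_sym y u] Hy su)
      (simp add: algebra_simps)
  moreover have "((\<lambda>h. quad n E \<alpha> s y + h * ((H *\<^sub>v y) $ i - \<alpha> * sv $ i)
      + h * h * (u \<bullet> (H *\<^sub>v u) / 2)) has_field_derivative (H *\<^sub>v y) $ i - \<alpha> * sv $ i) (at 0)"
    by (auto intro!: derivative_eq_intros)
  ultimately have "deriv (\<lambda>h. quad n E \<alpha> s (y + h \<cdot>\<^sub>v u)) 0 = (H *\<^sub>v y) $ i - \<alpha> * sv $ i"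
    by (simp only: DERIV_imp_deriv)
  then show "grad (quad n E \<alpha> s) y $ i = (H *\<^sub>v y - \<alpha> \<cdot>\<^sub>v sv) $ i"
    using i by (simp add: grad_def carrier_vecD[OF y] carrier_vecD[OF sv_carrier] u_def)
qed (simp add: grad_def carrier_vecD[OF y] carrier_vecD[OF sv_carrier])

text \<open>The lower spectral bound leaves H a trivial kernel, so its determinant is nonzero and a
  right inverse supplies the solution.\<close>

lemma H_solvable: "\<exists>y\<in>carrier_vec n. H *\<^sub>v y = \<alpha> \<cdot>\<^sub>v sv"
proof -
  have "det H \<noteq> 0"
  proof
    assume "det H = 0"
    then obtain v where v: "v \<in> carrier_vec n" "v \<noteq> 0\<^sub>v n" "H *\<^sub>v v = 0\<^sub>v n"
      unfolding det_0_iff_vec_prod_zero[OF H_carrier] by blast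
    then have "\<alpha> * (v \<bullet> v) \<le> 0" using lower[OF v(1)] by simp
    then have "v \<bullet> v = 0" using scalar_prod_self_nonneg[of v] alpha_pos by (simp add: mult_le_0_iff)
    then have "v = 0\<^sub>v n"
      using v(1) by (intro eq_vecI) (auto simp: scalar_prod_def sum_nonneg_eq_0_iff)
    with v show False by simp
  qed
  \<comment> \<open>\<open>()\<close> is the trivial record extension of the matrix ring.\<close>
  from det_non_zero_imp_unit[OF H_carrier this, of "()"]
  obtain B where B: "B \<in> carrier_mat n n" "H * B = 1\<^sub>m n"
    by (auto simp: Units_def ring_mat_def)
  have "H *\<^sub>v (B *\<^sub>v (\<alpha> \<cdot>\<^sub>v sv)) = \<alpha> \<cdot>\<^sub>v sv"
    using assoc_mult_mat_vec[OF H_carrier B(1), of "\<alpha> \<cdot>\<^sub>v sv"] by (simp add: B(2))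
  moreover have "B *\<^sub>v (\<alpha> \<cdot>\<^sub>v sv) \<in> carrier_vec n"
    using B(1) by (rule mult_mat_vec_carrier) simp
  ultimately show ?thesis by blast
qed

end

section \<open>Cost of the counted primitives\<close>

lemma run_state_ops [simp]:
  "run_state (add_op a b) k = (a + b, Suc k)"
  "run_state (sub_op a b) k = (a - b, Suc k)"
  "run_state (mul_op a b) k = (a * b, Suc k)"
  by (simp_all add: add_op_def sub_op_def mul_op_def charge_def)

text \<open>Results and costs that do not depend on the counter separate into a map and a sum, which
  reduces each vector primitive to its cost per entry.\<close>

lemma run_state_traverse_list:
  assumes "\<And>x k. x \<in> set xs \<Longrightarrow> run_state (f x) k = (g x, k + c x)"
  shows "run_state (State_Monad.traverse_list f xs) k = (map g xs, k + sum_list (map c xs))"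
  using assms by (induction xs arbitrary: k) (simp_all add: add.assoc)

lemma run_state_scale_op [simp]:
  "run_state (scale_op a xs) k = (map ((*) a) xs, k + length xs)"
  unfolding scale_op_def
  by (subst run_state_traverse_list[where g = "(*) a" and c = "\<lambda>_. 1"]) (simp_all add: sum_list_triv)

lemma run_state_zip_op:
  assumes "\<And>x y k. run_state (f x y) k = (h x y, Suc k)"
  shows "run_state (zip_op f xs ys) k = (map2 h xs ys, k + min (length xs) (length ys))"
  unfolding zip_op_def
  by (subst run_state_traverse_list[where g = "\<lambda>(x, y). h x y" and c = "\<lambda>_. 1"])
    (auto simp: sum_list_triv assms)

text \<open>Each stored entry costs one multiplication and one addition, the addition to the initial
  0 included.\<close>

lemma run_state_sparse_dot:
  "run_state (sparse_dot ys r) k = ((\<Sum>(j, p)\<leftarrow>r. p * ys ! j), k + 2 * length r)"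
  by (induction r arbitrary: k) auto

text \<open>Entries omitted from a sparse row are zero, so the filtered sums are full scalar
  products while only the nonzero entries are charged.\<close>

lemma run_state_sparse_mult:
  assumes v: "v \<in> carrier_vec (dim_col M)"
  shows "run_state (sparse_mult (sparse_rows M) (list_of_vec v)) k =
    (list_of_vec (M *\<^sub>v v), k + 2 * (\<Sum>i<dim_row M. card {j. j < dim_col M \<and> M $$ (i, j) \<noteq> 0}))"
proof -
  have len: "length (filter (\<lambda>j. M $$ (i, j) \<noteq> 0) [0..<dim_col M]) = card {j. j < dim_col M \<and> M $$ (i, j) \<noteq> 0}"
    for i by (subst distinct_card[symmetric]) (auto intro!: arg_cong[where f = card])
  have dot: "(\<Sum>j\<leftarrow>filter (\<lambda>j. M $$ (i, j) \<noteq> 0) [0..<dim_col M]. M $$ (i, j) * v $ j) = row M i \<bullet> v"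
    if "i < dim_row M" for i
  proof -
    have "(\<Sum>j\<leftarrow>filter (\<lambda>j. M $$ (i, j) \<noteq> 0) [0..<dim_col M]. M $$ (i, j) * v $ j) =
        (\<Sum>j\<leftarrow>[0..<dim_col M]. M $$ (i, j) * v $ j)"
      by (rule sum_list_map_filter) simp
    also have "\<dots> = row M i \<bullet> v"
      using that carrier_vecD[OF v]
      by (simp add: scalar_prod_def interv_sum_list_conv_sum_set_nat)
    finally show ?thesis .
  qed
  have "run_state (sparse_mult (sparse_rows M) (list_of_vec v)) k =
      (map (\<lambda>r. \<Sum>(j, p)\<leftarrow>r. p * list_of_vec v ! j) (sparse_rows M),
       k + sum_list (map (\<lambda>r. 2 * length r) (sparse_rows M)))"
    unfolding sparse_mult_def by (rule run_state_traverse_list) (rule run_state_sparse_dot)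
  also have "map (\<lambda>r. \<Sum>(j, p)\<leftarrow>r. p * list_of_vec v ! j) (sparse_rows M) = list_of_vec (M *\<^sub>v v)"
    by (intro nth_equalityI) (auto simp: sparse_rows_def list_of_vec_index comp_def dot)
  also have "sum_list (map (\<lambda>r. 2 * length r) (sparse_rows M)) =
      2 * (\<Sum>i<dim_row M. card {j. j < dim_col M \<and> M $$ (i, j) \<noteq> 0})"
    by (simp add: sparse_rows_def comp_def len interv_sum_list_conv_sum_set_nat sum_distrib_left
        atLeast0LessThan)
  finally show ?thesis .
qed

lemma list_of_vec_smult: "list_of_vec (c \<cdot>\<^sub>v v) = map ((*) c) (list_of_vec v)"
  by (intro nth_equalityI) (auto simp: list_of_vec_index)

lemma list_of_vec_minus:
  "dim_vec u = dim_vec v \<Longrightarrow> list_of_vec (u - v) = map2 (-) (list_of_vec u) (list_of_vec v)"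
  by (intro nth_equalityI) (auto simp: list_of_vec_index)

lemma list_of_vec_add:
  "dim_vec u = dim_vec v \<Longrightarrow> list_of_vec (u + v) = map2 (+) (list_of_vec u) (list_of_vec v)"
  by (intro nth_equalityI) (auto simp: list_of_vec_index)

section \<open>Error and cost of the iteration\<close>

context ppr_problem
begin

section \<open>The iterates and their second-order recurrence\<close>

definition z_iter :: "nat \<Rightarrow> real vec" where
  "z_iter t = fst (nag (quad n E \<alpha> s) (eta \<alpha>) (beta \<alpha>) n t)"

lemma iter_carrier [simp]: "z_iter t \<in> carrier_vec n" "y_iter n E \<alpha> s t \<in> carrier_vec n"
  unfolding z_iter_def y_iter_def by (simp_all add: nag_carrier grad_quad)

lemma iter_0 [simp]: "z_iter 0 = 0\<^sub>v n" "y_iter n E \<alpha> s 0 = 0\<^sub>v n"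
  by (simp_all add: z_iter_def y_iter_def)

text \<open>The gradient is bracketed as in \<open>nag_step\<close>, so that the program can be
  matched operation by operation.\<close>

lemma z_iter_Suc:
  "z_iter (Suc t) = y_iter n E \<alpha> s t - eta \<alpha> \<cdot>\<^sub>v
     (y_iter n E \<alpha> s t - (1 - \<alpha>) \<cdot>\<^sub>v (P *\<^sub>v y_iter n E \<alpha> s t) - \<alpha> \<cdot>\<^sub>v sv)"
proof -
  have "z_iter (Suc t) = y_iter n E \<alpha> s t - eta \<alpha> \<cdot>\<^sub>v grad (quad n E \<alpha> s) (y_iter n E \<alpha> s t)"
    by (simp add: z_iter_def y_iter_def Let_def case_prod_beta)
  then show ?thesis by (simp only: grad_quad H_mult_vec iter_carrier)
qed

lemma y_iter_Suc:
  "y_iter n E \<alpha> s (Suc t) = z_iter (Suc t) + beta \<alpha> \<cdot>\<^sub>v (z_iter (Suc t) - z_iter t)"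
  by (simp add: z_iter_def y_iter_def Let_def case_prod_beta)

text \<open>The coefficients of y and P y in the gradient step agree, since 1 -
  \<open>eta \<alpha>\<close> = (1 - \<alpha>) \<open>eta \<alpha>\<close>; hence the factor I +
  P.\<close>

lemma z_iter_Suc_index:
  assumes i: "i < n"
  shows "z_iter (Suc t) $ i = (1 - \<alpha>) / (2 - \<alpha>) * (((1\<^sub>m n + P) *\<^sub>v y_iter n E \<alpha> s t) $ i)
     + (kappa \<alpha>)\<^sup>2 * sv $ i"
proof -
  define y Py where "y = y_iter n E \<alpha> s t" and "Py = P *\<^sub>v y"
  have [simp]: "y \<in> carrier_vec n" "Py \<in> carrier_vec n" by (simp_all add: y_def Py_def)
  have dims: "dim_vec y = n" "dim_vec Py = n" "dim_vec sv = n" by (simp_all add: carrier_vecD[of _ n])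
  have "(1\<^sub>m n + P) *\<^sub>v y = y + Py"
    by (simp add: add_mult_distrib_mat_vec[of _ n n] Py_def)
  then have idx: "((1\<^sub>m n + P) *\<^sub>v y) $ i = y $ i + Py $ i" using i by (simp add: dims)
  \<comment> \<open>All coefficients are affine in this w, which is \<open>eta \<alpha>\<close>, so
    the claim becomes polynomial.\<close>
  define w where "w = 1 / (2 - \<alpha>)"
  have w: "(1 - \<alpha>) / (2 - \<alpha>) = 1 - w" "\<alpha> / (2 - \<alpha>) = 2 * w - 1"
    "w * ((1 - \<alpha>) * x) = (1 - w) * x" "w * (\<alpha> * x) = (2 * w - 1) * x" for x
    using alpha_less by (simp_all add: w_def field_simps)
  have "z_iter (Suc t) $ i = y $ i - w * y $ i + w * ((1 - \<alpha>) * Py $ i) + w * (\<alpha> * sv $ i)"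
    unfolding z_iter_Suc y_def[symmetric] Py_def[symmetric] eta_def w_def[symmetric]
    using i by (simp add: dims right_diff_distrib del: index_mult_mat_vec)
  then show ?thesis
    unfolding y_def[symmetric] kappa_sq idx w by (simp add: algebra_simps)
qed

text \<open>For t \<ge> 1 the current and the next z are both gradient steps and can be eliminated;
  at t = 0 the current z is the initial vector. The source terms combine to (1 +
  \<open>beta \<alpha>\<close>) - \<open>beta \<alpha>\<close> = 1 times
  \<open>(kappa \<alpha>)\<^sup>2\<close>.\<close>

lemma y_iter_recurrence:
  assumes "1 \<le> t"
  shows "y_iter n E \<alpha> s (t + 1) =
            (2 * eta' \<alpha>) \<cdot>\<^sub>v ((1\<^sub>m n + P) *\<^sub>v y_iter n E \<alpha> s t)
            - ((1 - kappa \<alpha>) * eta' \<alpha>) \<cdot>\<^sub>v ((1\<^sub>m n + P) *\<^sub>v y_iter n E \<alpha> s (t - 1))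
            + (kappa \<alpha>)\<^sup>2 \<cdot>\<^sub>v sv"
proof -
  obtain r where t: "t = Suc r" using assms by (cases t) auto
  have carr: "(1\<^sub>m n + P) *\<^sub>v y_iter n E \<alpha> s k \<in> carrier_vec n" for k
    by (rule mult_mat_vec_carrier[of _ n n]) simp_all
  have dims: "dim_vec ((1\<^sub>m n + P) *\<^sub>v y_iter n E \<alpha> s k) = n" "dim_vec sv = n"
    "dim_vec (y_iter n E \<alpha> s k) = n" "dim_vec (z_iter k) = n" for k
    by (rule carrier_vecD; simp add: carr)+
  show ?thesis
  proof (rule eq_vecI)
    fix i assume "i < dim_vec ((2 * eta' \<alpha>) \<cdot>\<^sub>v ((1\<^sub>m n + P) *\<^sub>v y_iter n E \<alpha> s t)
            - ((1 - kappa \<alpha>) * eta' \<alpha>) \<cdot>\<^sub>v ((1\<^sub>m n + P) *\<^sub>v y_iter n E \<alpha> s (t - 1))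
            + (kappa \<alpha>)\<^sup>2 \<cdot>\<^sub>v sv)"
    then have i: "i < n" by (simp add: dims)
    define p q where "p = ((1\<^sub>m n + P) *\<^sub>v y_iter n E \<alpha> s t) $ i"
      and "q = ((1\<^sub>m n + P) *\<^sub>v y_iter n E \<alpha> s r) $ i"
    define c where "c = (1 - \<alpha>) / (2 - \<alpha>)"
    have z: "z_iter (Suc t) $ i = c * p + (kappa \<alpha>)\<^sup>2 * sv $ i" "z_iter t $ i = c * q + (kappa \<alpha>)\<^sup>2 * sv $ i"
      by (simp_all only: t z_iter_Suc_index[OF i] p_def q_def c_def)
    have "y_iter n E \<alpha> s (t + 1) $ i = z_iter (Suc t) $ i + beta \<alpha> * (z_iter (Suc t) $ i - z_iter t $ i)"
      using i by (simp add: y_iter_Suc dims)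
    also have "\<dots> = 2 * (c / (1 + kappa \<alpha>)) * p - (1 - kappa \<alpha>) * (c / (1 + kappa \<alpha>)) * q + (kappa \<alpha>)\<^sup>2 * sv $ i"
    proof -
      define w where "w = 1 / (1 + kappa \<alpha>)"
      have "beta \<alpha> = 2 * w - 1" "(1 - kappa \<alpha>) * (c / (1 + kappa \<alpha>)) = c * (2 * w - 1)"
        "c / (1 + kappa \<alpha>) = c * w"
        using kappa_pos by (simp_all add: beta_def w_def field_simps)
      then show ?thesis
        unfolding z by (simp only:) (simp add: algebra_simps)
    qed
    also have "c / (1 + kappa \<alpha>) = eta' \<alpha>" by (simp add: c_def eta'_def)
    finally show "y_iter n E \<alpha> s (t + 1) $ i = ((2 * eta' \<alpha>) \<cdot>\<^sub>v ((1\<^sub>m n + P) *\<^sub>v y_iter n E \<alpha> s t)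
            - ((1 - kappa \<alpha>) * eta' \<alpha>) \<cdot>\<^sub>v ((1\<^sub>m n + P) *\<^sub>v y_iter n E \<alpha> s (t - 1))
            + (kappa \<alpha>)\<^sup>2 \<cdot>\<^sub>v sv) $ i"
      using i by (simp add: dims p_def q_def t del: index_mult_mat_vec dim_mult_mat_vec)
  qed (simp add: dims)
qed

section \<open>The zero of the gradient and the personalised PageRank vector\<close>

definition y_opt :: "real vec" where
  "y_opt = (SOME y. y \<in> carrier_vec n \<and> H *\<^sub>v y = \<alpha> \<cdot>\<^sub>v sv)"

lemma y_opt: "y_opt \<in> carrier_vec n" "H *\<^sub>v y_opt = \<alpha> \<cdot>\<^sub>v sv"
  using someI_ex[of "\<lambda>y. y \<in> carrier_vec n \<and> H *\<^sub>v y = \<alpha> \<cdot>\<^sub>v sv"] H_solvable unfolding y_opt_def by blast+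

lemma H_inj:
  assumes [simp]: "u \<in> carrier_vec n" "v \<in> carrier_vec n" and "H *\<^sub>v u = H *\<^sub>v v"
  shows "u = v"
proof -
  have "H *\<^sub>v (u - v) = 0\<^sub>v n"
    unfolding mult_minus_distrib_mat_vec[OF H_carrier assms(1,2)] assms(3)
    by (intro eq_vecI) (simp_all add: carrier_matD[OF P_carrier])
  then have "\<alpha> * ((u - v) \<bullet> (u - v)) \<le> 0" using lower[of "u - v"] by simp
  then have *: "(u - v) \<bullet> (u - v) = 0"
    using scalar_prod_self_nonneg[of "u - v"] alpha_pos by (simp add: mult_le_0_iff)
  have dims: "dim_vec u = n" "dim_vec v = n" by (simp_all add: carrier_vecD[of _ n])
  have "(u $ i - v $ i) * (u $ i - v $ i) = 0" if "i < n" for i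
    using * that unfolding scalar_prod_def by (subst (asm) sum_nonneg_eq_0_iff) (auto simp: dims)
  then show ?thesis by (intro eq_vecI) (auto simp: dims)
qed

text \<open>Since \<open>A D\<^sup>-\<^sup>1 D\<^sup>1\<^sup>/\<^sup>2 = D\<^sup>1\<^sup>/\<^sup>2
  P\<close>, every term of the fixed-point equation carries the factor
  \<open>D\<^sup>1\<^sup>/\<^sup>2\<close>, whose positive diagonal cancels entry by entry.\<close>

lemma ppr_eq_scaled_iff:
  assumes y [simp]: "y \<in> carrier_vec n"
  shows "ppr_eq n E \<alpha> s (deg_pow n E (1 / 2) *\<^sub>v y) \<longleftrightarrow> H *\<^sub>v y = \<alpha> \<cdot>\<^sub>v sv"
proof -
  let ?D = "deg_pow n E (1 / 2)"
  have D_carr: "deg_pow n E p *\<^sub>v v \<in> carrier_vec n" if "v \<in> carrier_vec n" for p v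
    by (rule mult_mat_vec_carrier[OF deg_pow_carrier that])
  have A_carr: "Defs.adj_mat n E * deg_pow n E p \<in> carrier_mat n n" for p
    by (rule mult_carrier_mat[OF adj_mat_carrier deg_pow_carrier])
  have assoc: "deg_pow n E p *\<^sub>v (deg_pow n E q *\<^sub>v v) = deg_pow n E (p + q) *\<^sub>v v"
    if "v \<in> carrier_vec n" for p q v
    unfolding deg_pow_add[symmetric] by (rule assoc_mult_mat_vec[symmetric, OF deg_pow_carrier deg_pow_carrier that])
  have "(Defs.adj_mat n E * deg_pow n E (- 1)) *\<^sub>v (?D *\<^sub>v y) = Defs.adj_mat n E *\<^sub>v (deg_pow n E (- 1 / 2) *\<^sub>v y)"
    unfolding assoc_mult_mat_vec[OF adj_mat_carrier deg_pow_carrier D_carr[OF y]] assoc[OF y] by simp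
  also have "\<dots> = ?D *\<^sub>v (P *\<^sub>v y)"
  proof -
    have "P *\<^sub>v y = deg_pow n E (- 1 / 2) *\<^sub>v (Defs.adj_mat n E *\<^sub>v (deg_pow n E (- 1 / 2) *\<^sub>v y))"
      unfolding P_mat_def
      by (rule trans[OF assoc_mult_mat_vec[OF mult_carrier_mat[OF deg_pow_carrier adj_mat_carrier] deg_pow_carrier y]
            assoc_mult_mat_vec[OF deg_pow_carrier adj_mat_carrier D_carr[OF y]]])
    then show ?thesis
      using deg_pow_inverse_mult_vec(2)[OF mult_mat_vec_carrier[OF adj_mat_carrier D_carr[OF y]]] by simp
  qed
  finally have AD: "(Defs.adj_mat n E * deg_pow n E (- 1)) *\<^sub>v (?D *\<^sub>v y) = ?D *\<^sub>v (P *\<^sub>v y)" .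
  define Py where "Py = P *\<^sub>v y"
  have Py [simp]: "Py \<in> carrier_vec n" by (simp add: Py_def)
  have dims: "dim_vec Py = n" "dim_vec y = n" "dim_vec sv = n" by (simp_all add: carrier_vecD[of _ n])
  define w where "w i = sqrt (deg i)" for i
  have w: "0 < w i" if "i < n" for i using deg_pos[OF that] by (simp add: w_def)
  have D_index: "(?D *\<^sub>v v) $ i = w i * v $ i" if "v \<in> carrier_vec n" "i < n" for v i
    using that by (simp add: deg_pow_mult_vec powr_half_sqrt w_def)
  have s_index: "w i * sv $ i = unit_vec n s $ i" if "i < n" for i

  proof -
    have "?D *\<^sub>v sv = unit_vec n s"
      unfolding s_vec_def by (rule deg_pow_inverse_mult_vec(2)) simp
    with D_index[OF sv_carrier that] show ?thesis by (simp only:)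
  qed
  have "ppr_eq n E \<alpha> s (?D *\<^sub>v y) \<longleftrightarrow>
      ?D *\<^sub>v y = \<alpha> \<cdot>\<^sub>v unit_vec n s + (1 - \<alpha>) \<cdot>\<^sub>v (?D *\<^sub>v Py)"
    by (simp only: ppr_eq_def AD D_carr y Py_def simp_thms)
  also have "\<dots> \<longleftrightarrow> (\<forall>i<n. w i * y $ i = \<alpha> * (w i * sv $ i) + (1 - \<alpha>) * (w i * Py $ i))"
    unfolding vec_eq_iff using carrier_vecD[OF D_carr[OF y]] carrier_vecD[OF D_carr[OF Py]]
    by (simp add: D_index s_index del: index_mult_mat_vec dim_mult_mat_vec)
  also have "\<dots> \<longleftrightarrow> (\<forall>i<n. y $ i - (1 - \<alpha>) * Py $ i = \<alpha> * sv $ i)"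
  proof (intro all_cong)
    fix i assume "i < n"
    have "w i * y $ i = \<alpha> * (w i * sv $ i) + (1 - \<alpha>) * (w i * Py $ i) \<longleftrightarrow>
       w i * (y $ i - (1 - \<alpha>) * Py $ i) = w i * (\<alpha> * sv $ i)" by (auto simp: algebra_simps)
    then show "w i * y $ i = \<alpha> * (w i * sv $ i) + (1 - \<alpha>) * (w i * Py $ i) \<longleftrightarrow>
       y $ i - (1 - \<alpha>) * Py $ i = \<alpha> * sv $ i" using w[OF \<open>i < n\<close>] by simp
  qed
  also have "\<dots> \<longleftrightarrow> H *\<^sub>v y = \<alpha> \<cdot>\<^sub>v sv"
    unfolding H_mult_vec[OF y] Py_def[symmetric] vec_eq_iff by (simp add: dims)
  finally show ?thesis .
qed

text \<open>As \<open>D\<^sup>1\<^sup>/\<^sup>2\<close> is invertible, every candidate x is a scaled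
  y, and \<open>H_inj\<close> leaves one choice. Existence, uniqueness and the value of the definite
  description follow together.\<close>

lemma ppr_eq_iff: "ppr_eq n E \<alpha> s x \<longleftrightarrow> x = deg_pow n E (1 / 2) *\<^sub>v y_opt"
proof
  assume x: "ppr_eq n E \<alpha> s x"
  then have xc: "x \<in> carrier_vec n" by (simp add: ppr_eq_def)
  define y where "y = deg_pow n E (- 1 / 2) *\<^sub>v x"
  have y: "y \<in> carrier_vec n" unfolding y_def by (rule mult_mat_vec_carrier[OF deg_pow_carrier xc])
  have xy: "x = deg_pow n E (1 / 2) *\<^sub>v y" unfolding y_def by (rule deg_pow_inverse_mult_vec(2)[OF xc, symmetric])
  have Hy: "H *\<^sub>v y = \<alpha> \<cdot>\<^sub>v sv"
    using x by (simp only: xy ppr_eq_scaled_iff[OF y])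
  have "y = y_opt"
    by (rule H_inj[OF y y_opt(1) trans[OF Hy y_opt(2)[symmetric]]])
  with xy show "x = deg_pow n E (1 / 2) *\<^sub>v y_opt" by simp
next
  assume "x = deg_pow n E (1 / 2) *\<^sub>v y_opt"
  then show "ppr_eq n E \<alpha> s x" using ppr_eq_scaled_iff y_opt by simp
qed

lemma ppr_eq_unique: "\<exists>!x. ppr_eq n E \<alpha> s x"
  by (simp add: ppr_eq_iff)

lemma ppr_conv: "ppr n E \<alpha> s = deg_pow n E (1 / 2) *\<^sub>v y_opt"
  by (simp add: ppr_def ppr_eq_iff)

section \<open>Error bounds in the 1-norm and the maximum norm\<close>

abbreviation "err t \<equiv> y_iter n E \<alpha> s t - y_opt"

lemma err_carrier [simp]: "err t \<in> carrier_vec n"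
  using y_opt by simp

lemma x_iter_error: "x_iter n E \<alpha> s t - ppr n E \<alpha> s = vec n (\<lambda>i. sqrt (deg i) * err t $ i)"
proof -
  have "x_iter n E \<alpha> s t - ppr n E \<alpha> s = deg_pow n E (1 / 2) *\<^sub>v err t"
    unfolding ppr_conv x_iter_def by (rule mult_minus_distrib_mat_vec[symmetric, of _ n n]) (simp_all add: y_opt)
  then show ?thesis by (simp only: deg_pow_mult_vec err_carrier) (simp add: powr_half_sqrt)
qed

text \<open>Optimality and the lower bound give |y_opt|^2 \<le> y_opt . sv. With 2 (y_opt . sv)
  \<le> |y_opt|^2 + |sv|^2 both are at most |sv|^2 \<le> 1, so each half of the Lyapunov value is at
  most \<alpha> / 2.\<close>

lemma lyapunov_y_opt: "lyapunov y_opt y_opt \<le> \<alpha>"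
proof -
  note [simp] = y_opt(1)
  have "0 \<le> (y_opt - sv) \<bullet> (y_opt - sv)" by (rule scalar_prod_self_nonneg)
  then have "2 * (y_opt \<bullet> sv) \<le> y_opt \<bullet> y_opt + sv \<bullet> sv"
    by (simp add: vec_expand comm_scalar_prod[of sv n y_opt])
  moreover have opt: "y_opt \<bullet> (H *\<^sub>v y_opt) = \<alpha> * (y_opt \<bullet> sv)"
    by (simp add: y_opt(2) scalar_prod_smult_distrib[of _ n])
  moreover have "y_opt \<bullet> y_opt \<le> y_opt \<bullet> sv"
    using lower[of y_opt] alpha_pos unfolding opt by simp
  ultimately have "\<alpha> * (y_opt \<bullet> y_opt) \<le> \<alpha> * 1" "y_opt \<bullet> (H *\<^sub>v y_opt) \<le> \<alpha> * 1"
    using sv_norm alpha_pos unfolding opt by (auto intro!: mult_left_mono)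
  then show ?thesis unfolding lyapunov_def by simp
qed

lemma err_sq: "err t \<bullet> err t \<le> 2 * exp (- kappa \<alpha> * real t)"
proof -
  have "\<alpha> / 2 * (err t \<bullet> err t) \<le> (1 - kappa \<alpha>) ^ t * lyapunov y_opt y_opt"
    unfolding y_iter_def eta_def beta_def
    by (rule nag_quadratic_error) (simp_all add: grad_quad y_opt)
  \<comment> \<open>Here 1 - \<kappa> \<le> exp (-\<kappa>); the initial value \<alpha> then cancels
    against \<alpha> / 2 and leaves the factor 2.\<close>
  also have "\<dots> \<le> exp (- kappa \<alpha>) ^ t * \<alpha>"
    using kappa_le_1 exp_ge_add_one_self[of "- kappa \<alpha>"] lyapunov_y_opt alpha_pos
    by (intro mult_mono power_mono) (auto simp: lyapunov_def scalar_prod_self_nonneg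
        intro!: add_nonneg_nonneg order_trans[OF _ lower[OF y_opt(1)]])
  finally have "err t \<bullet> err t \<le> 2 * exp (- kappa \<alpha>) ^ t"
    using alpha_pos by (simp add: field_simps)
  then show ?thesis by (simp add: exp_of_nat_mult[symmetric] mult.commute)
qed

lemma err_norm: "sqrt (err t \<bullet> err t) \<le> sqrt 2 * exp (- (kappa \<alpha> * real t / 2))"
proof -
  have "sqrt (err t \<bullet> err t) \<le> sqrt (2 * exp (- kappa \<alpha> * real t))"
    using err_sq by (rule real_sqrt_le_mono)
  also have "exp (- kappa \<alpha> * real t) = (exp (- (kappa \<alpha> * real t / 2)))\<^sup>2"
    by (simp add: power2_eq_square exp_add[symmetric])
  finally show ?thesis by (simp add: real_sqrt_mult)
qed

lemma norm1_error:
  "norm1 (x_iter n E \<alpha> s t - ppr n E \<alpha> s) \<le> sqrt (real n * dmax) * (sqrt 2 * exp (- (kappa \<alpha> * real t / 2)))"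
proof -
  have "norm1 (x_iter n E \<alpha> s t - ppr n E \<alpha> s) = (\<Sum>i<n. \<bar>sqrt (deg i)\<bar> * \<bar>err t $ i\<bar>)"
    unfolding x_iter_error norm1_def by (simp add: abs_mult)
  also have "\<dots> \<le> L2_set (\<lambda>i. sqrt (deg i)) {..<n} * L2_set (\<lambda>i. err t $ i) {..<n}"
    by (rule L2_set_mult_ineq)
  also have "L2_set (\<lambda>i. err t $ i) {..<n} = sqrt (err t \<bullet> err t)"
    using carrier_vecD[OF err_carrier, of t] unfolding L2_set_def scalar_prod_def
    by (simp only: power2_eq_square atLeast0LessThan)
  also have "L2_set (\<lambda>i. sqrt (deg i)) {..<n} * \<dots> \<le>
      sqrt (real n * dmax) * (sqrt 2 * exp (- (kappa \<alpha> * real t / 2)))"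
  proof (rule mult_mono[OF _ err_norm])
    show "L2_set (\<lambda>i. sqrt (deg i)) {..<n} \<le> sqrt (real n * dmax)"
      unfolding L2_set_def using sum_bounded_above[of "{..<n}" deg dmax] deg_le_dmax
      by (intro real_sqrt_le_mono) simp
  qed (simp_all add: scalar_prod_self_nonneg)
  finally show ?thesis .
qed

text \<open>A single entry is bounded by the Euclidean norm, without the factor sqrt n that
  Cauchy-Schwarz costs in the 1-norm.\<close>

lemma norm_inf_error:
  "norm_inf (x_iter n E \<alpha> s t - ppr n E \<alpha> s) \<le> sqrt (2 * dmax) * exp (- (kappa \<alpha> * real t / 2))"
proof -
  have "\<bar>sqrt (deg i) * err t $ i\<bar> \<le> sqrt dmax * (sqrt 2 * exp (- (kappa \<alpha> * real t / 2)))" if i: "i < n" for i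
  proof -
    have "(err t $ i)\<^sup>2 \<le> err t \<bullet> err t"
      using carrier_vecD[OF err_carrier, of t] i unfolding scalar_prod_def power2_eq_square
      by (intro member_le_sum) auto
    then have "\<bar>err t $ i\<bar> \<le> sqrt (err t \<bullet> err t)" by (rule real_le_rsqrt[of "\<bar>_\<bar>", simplified])
    with err_norm[of t] have "\<bar>err t $ i\<bar> \<le> sqrt 2 * exp (- (kappa \<alpha> * real t / 2))" by linarith
    moreover have "\<bar>sqrt (deg i)\<bar> \<le> sqrt dmax" using deg_le_dmax[OF i] by simp
    ultimately show ?thesis unfolding abs_mult by (intro mult_mono) simp_all
  qed
  then show ?thesis
    unfolding x_iter_error norm_inf_def using s_less by (subst Max_le_iff) (auto simp: real_sqrt_mult mult_ac)
qed

lemma sqrt_dmax_sq_mult: "sqrt (dmax\<^sup>2 * x) = dmax * sqrt x"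
  by (simp add: real_sqrt_mult)

text \<open>This weakens \<open>norm1_error\<close>: \<open>dmax \<ge> 1\<close> and
  \<open>\<alpha> < 1\<close> enlarge the factor, t is lowered to t - 1, and
  \<open>1 / kappa \<alpha>\<close> is the square root in the exponent.\<close>

lemma norm1_rate:
  "norm1 (x_iter n E \<alpha> s t - ppr n E \<alpha> s)
     \<le> dmax * sqrt (2 * real n / \<alpha>) * exp (- ((real t - 1) / (2 * sqrt ((2 - \<alpha>) / \<alpha>))))"
proof -
  have sq: "sqrt ((2 - \<alpha>) / \<alpha>) = 1 / kappa \<alpha>"
    by (simp add: kappa_def real_sqrt_divide)
  have "sqrt (real n * dmax) * sqrt 2 \<le> sqrt (dmax\<^sup>2 * (2 * real n / \<alpha>))"
  proof -
    have "dmax * 1 \<le> dmax * dmax" using dmax_ge_1 by (intro mult_left_mono) auto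
    then have "2 * real n * dmax \<le> 2 * real n * dmax\<^sup>2" by (simp add: mult_left_mono power2_eq_square)
    also have "\<dots> \<le> 2 * real n * dmax\<^sup>2 / \<alpha>"
      using alpha_pos alpha_less by (simp add: le_divide_eq mult_left_le)
    finally show ?thesis unfolding real_sqrt_mult[symmetric] by (simp add: mult_ac)
  qed
  then have a: "sqrt (real n * dmax) * sqrt 2 \<le> dmax * sqrt (2 * real n / \<alpha>)"
    by (simp only: sqrt_dmax_sq_mult)
  have b: "exp (- (kappa \<alpha> * real t / 2)) \<le> exp (- ((real t - 1) / (2 * sqrt ((2 - \<alpha>) / \<alpha>))))"
    using kappa_pos unfolding sq by (simp add: algebra_simps)
  have "sqrt (real n * dmax) * sqrt 2 * exp (- (kappa \<alpha> * real t / 2)) \<le>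
      dmax * sqrt (2 * real n / \<alpha>) * exp (- ((real t - 1) / (2 * sqrt ((2 - \<alpha>) / \<alpha>))))"
    by (rule mult_mono[OF a b]) (use alpha_pos in simp_all)
  with norm1_error[of t] show ?thesis by (simp add: mult.assoc)
qed

section \<open>Operation count and accuracy\<close>

lemma sum_nonzeros: "(\<Sum>i<dim_row P. card {j. j < dim_col P \<and> P $$ (i, j) \<noteq> 0}) = 2 * card E"
proof -
  have "P $$ (i, j) \<noteq> 0 \<longleftrightarrow> {i, j} \<in> E" if "i < n" "j < n" for i j
    using that deg_pos[OF that(1)] deg_pos[OF that(2)] by (simp add: P_entry)
  then have "{j. j < n \<and> P $$ (i, j) \<noteq> 0} = {j. j < n \<and> {i, j} \<in> E}" if "i < n" for i
    using that by blast
  then show ?thesis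
    by (simp add: carrier_matD[OF P_carrier] vdegree_eq_card_neighbours[symmetric] sum_vdegree)
qed

lemma list_of_vec_x_iter:
  "list_of_vec (x_iter n E \<alpha> s t) = map2 (*) (diag_mat (deg_pow n E (1 / 2))) (list_of_vec (y_iter n E \<alpha> s t))"
  unfolding x_iter_def deg_pow_mult_vec[OF iter_carrier(2)]
  by (intro nth_equalityI) (simp_all add: carrier_vecD[OF iter_carrier(2)] diag_mat_def carrier_matD[OF deg_pow_carrier]
      list_of_vec_index, simp add: deg_pow_def mat_diag_def)

text \<open>The product with P costs two operations for each of its 2 m nonzero entries; the
  remaining ten lines of \<open>nag_step\<close> that compute are entrywise and cost n each.\<close>

lemma run_nag_prog:
  "run_state (nag_prog n E \<alpha> s t) k =
    ((list_of_vec (z_iter t), list_of_vec (y_iter n E \<alpha> s t), list_of_vec (x_iter n E \<alpha> s t)),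
     k + t * (4 * card E + 10 * n))"
proof (induction t arbitrary: k)
  case 0
  have "x_iter n E \<alpha> s 0 = 0\<^sub>v n"
    unfolding x_iter_def by (simp add: deg_pow_mult_vec) (auto intro!: eq_vecI)
  then show ?case by simp
next
  case (Suc t)
  have dims: "dim_vec (z_iter k) = n" "dim_vec (y_iter n E \<alpha> s k) = n" "dim_vec sv = n" "dim_row P = n" "dim_col P = n"
    "length (diag_mat (deg_pow n E (1 / 2))) = n" for k
    using P_carrier iter_carrier[of k] sv_carrier
    by (auto simp: carrier_vecD diag_mat_def carrier_matD[OF deg_pow_carrier] simp del: iter_carrier P_carrier sv_carrier)
  have mult: "run_state (sparse_mult (sparse_rows P) (list_of_vec (y_iter n E \<alpha> s t))) k =
      (list_of_vec (P *\<^sub>v y_iter n E \<alpha> s t), k + 4 * card E)" for k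
    by (subst run_state_sparse_mult) (simp_all add: sum_nonzeros, simp add: dims)
  show ?case
    by (simp add: Suc.IH nag_step_def mult run_state_zip_op[OF run_state_ops(1)] run_state_zip_op[OF run_state_ops(2)]
        run_state_zip_op[OF run_state_ops(3)] dims list_of_vec_x_iter y_iter_Suc z_iter_Suc
        list_of_vec_smult list_of_vec_minus list_of_vec_add)
qed

lemma nag_output_eq: "nag_output n E \<alpha> s t = x_iter n E \<alpha> s t"
  by (simp add: nag_output_def run_nag_prog vec_list)

lemma nag_ops_eq: "nag_ops n E \<alpha> s t = t * (4 * card E + 10 * n)"
  by (simp add: nag_ops_def run_nag_prog)

lemma step_cost_le: "real (4 * card E + 10 * n) \<le> 24 * real (card E)"
  using n_le by linarith

text \<open>The logarithm may vanish, so rounding the number of iterations up needs slack, found in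
  \<open>n \<ge> 2\<close>; the \<open>1\<close>-norm bound, being larger by \<open>\<surd>n\<close>, would not leave any when \<open>\<alpha>\<close> is close to \<open>1\<close> and
  \<open>d\<^sub>m\<^sub>a\<^sub>x = 1\<close>.\<close>

lemma iterations_for_accuracy:
  assumes eps: "0 < \<epsilon>" and Q: "1 \<le> dmax / \<epsilon> * sqrt (2 * real n / \<alpha>)"
  obtains T where "\<And>t. T \<le> t \<Longrightarrow> norm_inf (x_iter n E \<alpha> s t - ppr n E \<alpha> s) \<le> \<epsilon>"
    and "real T \<le> 6 * (1 / sqrt \<alpha> * ln (dmax / \<epsilon> * sqrt (2 * real n / \<alpha>)))"
proof -
  \<comment> \<open>The ratio of the maximum-norm bound at t = 0 to the target; the accuracy is
    reached once exp (-\<kappa> t / 2) \<le> 1 / q.\<close>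
  define q where "q = sqrt (2 * dmax) / \<epsilon>"
  have q_pos: "0 < q" using dmax_ge_1 eps by (simp add: q_def)
  have bound: "norm_inf (x_iter n E \<alpha> s t - ppr n E \<alpha> s) \<le> \<epsilon>" if "ln q \<le> kappa \<alpha> * real t / 2" for t
  proof -
    have "exp (- (kappa \<alpha> * real t / 2)) \<le> exp (- ln q)" using that by simp
    also have "\<dots> = 1 / q" using q_pos by (simp add: exp_minus inverse_eq_divide)
    finally have "sqrt (2 * dmax) * exp (- (kappa \<alpha> * real t / 2)) \<le> sqrt (2 * dmax) * (1 / q)"
      by (rule mult_left_mono) simp
    also have "\<dots> = \<epsilon>" using dmax_ge_1 eps by (simp add: q_def)
    finally show ?thesis using norm_inf_error[of t] by linarith
  qed
  show thesis
  proof (cases "q \<le> 1")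
    \<comment> \<open>The bound at t = 0 already meets the target, so T = 0; \<open>Q\<close> makes
      the logarithm nonnegative.\<close>
    case True
    show thesis
    proof
      fix t :: nat
      have "ln q \<le> 0" using True q_pos by simp
      also have "0 \<le> kappa \<alpha> * real t / 2" using kappa_pos by simp
      finally show "norm_inf (x_iter n E \<alpha> s t - ppr n E \<alpha> s) \<le> \<epsilon>" by (rule bound)
    next
      show "real 0 \<le> 6 * (1 / sqrt \<alpha> * ln (dmax / \<epsilon> * sqrt (2 * real n / \<alpha>)))"
        using Q alpha_pos by simp
    qed
  next
    case False
    define T where "T = nat \<lceil>2 / kappa \<alpha> * ln q\<rceil>"
    have T_ge: "2 / kappa \<alpha> * ln q \<le> real T" unfolding T_def by linarith
    have T_le: "real T \<le> 2 / kappa \<alpha> * ln q + 1"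
    proof -
      have "0 \<le> 2 / kappa \<alpha> * ln q" using False kappa_pos by simp
      then show ?thesis unfolding T_def by linarith
    qed
    show thesis
    proof
      fix t assume "T \<le> t"
      then have "2 / kappa \<alpha> * ln q \<le> real t" using T_ge by linarith
      then show "norm_inf (x_iter n E \<alpha> s t - ppr n E \<alpha> s) \<le> \<epsilon>"
        using kappa_pos by (intro bound) (simp add: field_simps)
    next
      define l where "l = ln (dmax / \<epsilon> * sqrt (2 * real n / \<alpha>))"
      have n2: "2 \<le> real n"
      proof -
        obtain e where "e \<in> E" using no_isolated s_less by (auto simp: no_isolated_def)
        then have "card e = 2" "e \<subseteq> {..<n}" using graph by (auto simp: simple_graph_def)
        then show ?thesis using card_mono[of "{..<n}" e] by simp
      qed
      \<comment> \<open>The slack: n \<ge> 2 leaves a factor sqrt 2 between q and the argument of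
        the logarithm, so l exceeds ln q by at least ln 2 / 2 \<ge> 1 / 4.\<close>
      have "q * sqrt 2 = sqrt (2 * dmax * 2) / \<epsilon>" by (simp add: q_def real_sqrt_mult)
      also have "\<dots> \<le> sqrt (dmax\<^sup>2 * (2 * real n / \<alpha>)) / \<epsilon>"
      proof -
        have "2 * dmax * 2 \<le> 2 * dmax * real n" using n2 by (intro mult_left_mono) auto
        also have "\<dots> = dmax * 1 * (2 * real n)" by simp
        also have "\<dots> \<le> dmax * dmax * (2 * real n)"
          using dmax_ge_1 by (intro mult_right_mono mult_left_mono) auto
        also have "\<dots> \<le> dmax\<^sup>2 * (2 * real n / \<alpha>)"
          using alpha_pos alpha_less unfolding power2_eq_square
          by (intro mult_left_mono) (simp_all add: le_divide_eq mult_left_le)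
        finally show ?thesis using eps by (simp add: divide_right_mono)
      qed
      also have "\<dots> = dmax / \<epsilon> * sqrt (2 * real n / \<alpha>)" by (simp only: sqrt_dmax_sq_mult) simp
      finally have "ln (q * sqrt 2) \<le> l" unfolding l_def using q_pos by (intro ln_mono) auto
      then have l: "ln q + ln 2 / 2 \<le> l" using q_pos by (simp add: ln_mult ln_sqrt)
      have "1 / 2 \<le> ln (2 :: real)"
        using ln_2_less_1 ln_add_one_self_le_self2[of "-1/2"] by (simp add: ln_div)
      then have l4: "ln q + 1 / 4 \<le> l" using l by linarith
      have lnq: "0 < ln q" using False by simp
      have k: "1 / kappa \<alpha> \<le> 3 / 2 * (1 / sqrt \<alpha>)"
      proof -
        have "1 / kappa \<alpha> = sqrt (2 - \<alpha>) / sqrt \<alpha>" by (simp add: kappa_def real_sqrt_divide)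
        \<comment> \<open>A rational bound above sqrt 2.\<close>
        also have "sqrt (2 - \<alpha>) \<le> 3 / 2" using alpha_pos by (intro real_le_lsqrt) (auto simp: power2_eq_square)
        finally show ?thesis using alpha_pos by (simp add: divide_right_mono)
      qed
      have a1: "1 \<le> 1 / sqrt \<alpha>" using alpha_pos alpha_less by simp
      have "real T \<le> 2 * ln q * (1 / kappa \<alpha>) + 1 * 1" using T_le by simp
      \<comment> \<open>The 1 from rounding up is paid by 4 (l - ln q) \<ge> 1 and 1 / sqrt \<alpha>
        \<ge> 1.\<close>
      also have "\<dots> \<le> 2 * ln q * (3 / 2 * (1 / sqrt \<alpha>)) + 4 * (l - ln q) * (1 / sqrt \<alpha>)"
        using k a1 l4 lnq kappa_pos by (intro add_mono mult_mono) auto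
      also have "\<dots> = (4 * l - ln q) * (1 / sqrt \<alpha>)" by (simp add: algebra_simps)
      also have "\<dots> \<le> (6 * l) * (1 / sqrt \<alpha>)" using l4 lnq alpha_pos by (intro mult_right_mono) auto
      finally show "real T \<le> 6 * (1 / sqrt \<alpha> * ln (dmax / \<epsilon> * sqrt (2 * real n / \<alpha>)))"
        by (simp add: l_def)
    qed
  qed
qed

end

theorem theorem6:
  shows "(\<forall>n E \<alpha> s.
      simple_graph n E \<and> no_isolated n E \<and> 0 < \<alpha> \<and> \<alpha> < 1 \<and> s < n \<longrightarrow>
        (\<exists>!x. ppr_eq n E \<alpha> s x) \<and>
        (\<forall>t\<ge>1. y_iter n E \<alpha> s (t + 1) =
            (2 * eta' \<alpha>) \<cdot>\<^sub>v ((1\<^sub>m n + P_mat n E) *\<^sub>v y_iter n E \<alpha> s t)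
            - ((1 - kappa \<alpha>) * eta' \<alpha>) \<cdot>\<^sub>v ((1\<^sub>m n + P_mat n E) *\<^sub>v y_iter n E \<alpha> s (t - 1))
            + (kappa \<alpha>)\<^sup>2 \<cdot>\<^sub>v s_vec n E s) \<and>
        (\<forall>t. norm1 (x_iter n E \<alpha> s t - ppr n E \<alpha> s)
            \<le> real (max_degree n E) * sqrt (2 * real n / \<alpha>)
              * exp (- ((real t - 1) / (2 * sqrt ((2 - \<alpha>) / \<alpha>))))))
    \<and> (\<exists>C>0. \<forall>n E \<alpha> s.
      simple_graph n E \<and> no_isolated n E \<and> 0 < \<alpha> \<and> \<alpha> < 1 \<and> s < n \<longrightarrow>
        (\<forall>t. nag_output n E \<alpha> s t = x_iter n E \<alpha> s t) \<and>
        (\<forall>t. real (nag_ops n E \<alpha> s (Suc t)) \<le> real (nag_ops n E \<alpha> s t) + C * real (card E)) \<and>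
        (\<forall>\<epsilon>>0. 1 \<le> real (max_degree n E) / \<epsilon> * sqrt (2 * real n / \<alpha>) \<longrightarrow>
          (\<exists>T. (\<forall>t\<ge>T. norm_inf (x_iter n E \<alpha> s t - ppr n E \<alpha> s) \<le> \<epsilon>) \<and>
            real (nag_ops n E \<alpha> s T)
              \<le> C * (real (card E) / sqrt \<alpha>
                  * ln (real (max_degree n E) / \<epsilon> * sqrt (2 * real n / \<alpha>))))))"
\<comment> \<open>The constant 144 is 6 from \<open>iterations_for_accuracy\<close> times 24 from
  \<open>step_cost_le\<close>; it also covers the cost of one step, which is at most 24 m.\<close>
proof (intro conjI exI[of _ "144 :: real"] allI impI, goal_cases)
  case (1 n E \<alpha> s)
  then interpret ppr_problem n E \<alpha> s by unfold_locales auto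
  show ?case by (rule ppr_eq_unique)
next
  case (2 n E \<alpha> s t)
  then interpret ppr_problem n E \<alpha> s by unfold_locales auto
  show ?case using 2 by (intro y_iter_recurrence)
next
  case (3 n E \<alpha> s t)
  then interpret ppr_problem n E \<alpha> s by unfold_locales auto
  show ?case by (rule norm1_rate)
next
  case 4
  show ?case by simp
next
  case (5 n E \<alpha> s t)
  then interpret ppr_problem n E \<alpha> s by unfold_locales auto
  show ?case by (rule nag_output_eq)
next
  case (6 n E \<alpha> s t)
  then interpret ppr_problem n E \<alpha> s by unfold_locales auto
  show ?case using step_cost_le by (simp add: nag_ops_eq)
next
  case (7 n E \<alpha> s \<epsilon>)
  then interpret ppr_problem n E \<alpha> s by unfold_locales auto
  obtain T where T: "\<And>t. T \<le> t \<Longrightarrow> norm_inf (x_iter n E \<alpha> s t - ppr n E \<alpha> s) \<le> \<epsilon>"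
    and T_le: "real T \<le> 6 * (1 / sqrt \<alpha> * ln (dmax / \<epsilon> * sqrt (2 * real n / \<alpha>)))"
    using iterations_for_accuracy 7 by metis
  have "real (nag_ops n E \<alpha> s T) = real T * real (4 * card E + 10 * n)"
    by (simp only: nag_ops_eq of_nat_mult)
  also have "\<dots> \<le> 6 * (1 / sqrt \<alpha> * ln (dmax / \<epsilon> * sqrt (2 * real n / \<alpha>))) * (24 * real (card E))"
    using T_le step_cost_le by (intro mult_mono) auto
  finally have "real (nag_ops n E \<alpha> s T) \<le> 144 * (real (card E) / sqrt \<alpha> * ln (dmax / \<epsilon> * sqrt (2 * real n / \<alpha>)))"
    by (simp add: mult_ac)
  with T show ?case by blast
qed

end
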